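(* Let $T$ be the equilateral triangle. There exists $\varepsilon_0\ge 1^\circ$ such that for all $\varepsilon\in(0,\varepsilon_0)$ and all $n$ we have $h(n,T,\varepsilon)=h(n)$. In particular, when $n$ is a power of $3$, $h(n,T,\varepsilon)=\frac{1}{24}(n^3-n)$.
   Context: A triangle with angles $\alpha',\beta',\gamma'$ is called $\varepsilon$-similar to a triangle $T$ with angles $\alpha,\beta,\gamma$ if, for a suitable labelling of its angles, $|\alpha-\alpha'|<\varepsilon$, $|\beta-\beta'|<\varepsilon$ and $|\gamma-\gamma'|<\varepsilon$. Here $\varepsilon>0$ is an angle smaller than any angle of $T$. $h(n,T,\varepsilon)$ denotes the maximal number of triangles (3-element subsets) in a set of $n$ points in the plane that are $\varepsilon$-similar to $T$. The sequence $h(n)$ (one argument) is defined recursively by $h(0)=h(1)=h(2)=0$, $h(3)=1$, and for $n\ge 3$ $$h(n)=\max\{abc+h(a)+h(b)+h(c):\ a+b+c=n,\ a,b,c\ge 0 \text{ integers},\ a,b,c<n\}.$$ *)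

theory Defs
  imports "HOL-Analysis.Analysis"
begin

text \<open>The angle at the vertex \<open>b\<close> of the triangle \<open>a b c\<close>, in radians.\<close>

definition angle_at :: "real^2 \<Rightarrow> real^2 \<Rightarrow> real^2 \<Rightarrow> real" where
  "angle_at a b c = arccos (((a - b) \<bullet> (c - b)) / (norm (a - b) * norm (c - b)))"

definition equilateral :: "real^2 \<Rightarrow> real^2 \<Rightarrow> real^2 \<Rightarrow> bool" where
  "equilateral A B C \<longleftrightarrow> A \<noteq> B \<and> dist A B = dist B C \<and> dist B C = dist C A"

text \<open>Triangles are 3-element point sets \<open>t\<close>; the reference triangle \<open>T\<close> is given by its
  vertices \<open>A\<close>, \<open>B\<close>, \<open>C\<close>. The choice of the enumeration \<open>p, q, r\<close> of \<open>t\<close> is the choice of a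
  labelling. A collinear \<open>t\<close> has angles 0, 0, \<open>\<pi>\<close>, so it is never \<open>\<epsilon>\<close>-similar to \<open>T\<close> when
  \<open>\<epsilon>\<close> is smaller than the angles of \<open>T\<close>.\<close>

definition eps_similar :: "real \<Rightarrow> real^2 \<Rightarrow> real^2 \<Rightarrow> real^2 \<Rightarrow> (real^2) set \<Rightarrow> bool" where
  "eps_similar \<epsilon> A B C t \<longleftrightarrow>
     (\<exists>p q r. t = {p, q, r} \<and> p \<noteq> q \<and> q \<noteq> r \<and> p \<noteq> r \<and>
        \<bar>angle_at C A B - angle_at r p q\<bar> < \<epsilon> \<and>
        \<bar>angle_at A B C - angle_at p q r\<bar> < \<epsilon> \<and>
        \<bar>angle_at B C A - angle_at q r p\<bar> < \<epsilon>)"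

definition num_similar :: "real \<Rightarrow> real^2 \<Rightarrow> real^2 \<Rightarrow> real^2 \<Rightarrow> (real^2) set \<Rightarrow> nat" where
  "num_similar \<epsilon> A B C P = card {t. t \<subseteq> P \<and> card t = 3 \<and> eps_similar \<epsilon> A B C t}"

text \<open>The quantity \<open>h(n, T, \<epsilon>)\<close>.\<close>

definition h_max :: "nat \<Rightarrow> real^2 \<Rightarrow> real^2 \<Rightarrow> real^2 \<Rightarrow> real \<Rightarrow> nat" where
  "h_max n A B C \<epsilon> = Max {num_similar \<epsilon> A B C P | P. finite P \<and> card P = n}"

text \<open>The recursive sequence \<open>h(n)\<close>. Its prescribed value \<open>h(3) = 1\<close> is the instance \<open>n = 3\<close> of
  the recursion.\<close>

function h_seq :: "nat \<Rightarrow> nat" where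
  "h_seq n =
     (if n < 3 then 0
      else Max ((\<lambda>(a, b, c). a * b * c + h_seq a + h_seq b + h_seq c) `
             {(a, b, c). a + b + c = n \<and> a < n \<and> b < n \<and> c < n}))"
  by auto
termination
  by (relation less_than) auto

declare h_seq.simps [simp del]

lemma h_seq_3: "h_seq 3 = 1"
proof -
  have small: "h_seq a = 0" if "a < 3" for a
    using that by (simp add: h_seq.simps)
  have "h_seq 3 = Max ((\<lambda>(a, b, c). a * b * c + h_seq a + h_seq b + h_seq c) `
             {(a, b, c). a + b + c = 3 \<and> a < 3 \<and> b < 3 \<and> c < 3})"
    by (subst h_seq.simps) simp
  also have "{(a, b, c). a + b + c = 3 \<and> a < 3 \<and> b < 3 \<and> c < (3::nat)} =
      {(1,1,1), (0,1,2), (0,2,1), (1,0,2), (1,2,0), (2,0,1), (2,1,0)}" (is "?L = ?R")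
  proof (rule set_eqI)
    fix x :: "nat \<times> nat \<times> nat"
    obtain a b c where x: "x = (a, b, c)" by (cases x)
    have "a = 0 \<or> a = 1 \<or> a = 2 \<or> a \<ge> 3" "b = 0 \<or> b = 1 \<or> b = 2 \<or> b \<ge> 3" by linarith+
    then show "x \<in> ?L \<longleftrightarrow> x \<in> ?R" unfolding x by (elim disjE) auto
  qed
  finally show ?thesis
    by (simp add: small)
qed

text \<open>The set over which \<open>h_max\<close> takes \<open>Max\<close> is finite and nonempty, so the maximum exists.\<close>

lemma h_max_set_finite: "finite {num_similar \<epsilon> A B C P | P. finite P \<and> card P = n}"
proof (rule finite_subset)
  show "{num_similar \<epsilon> A B C P | P. finite P \<and> card P = n} \<subseteq> {..2 ^ n}"
  proof clarsimp
    fix P :: "(real^2) set" assume P: "finite P"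
    have "card {t. t \<subseteq> P \<and> card t = 3 \<and> eps_similar \<epsilon> A B C t} \<le> card (Pow P)"
      using P by (intro card_mono) auto
    then show "num_similar \<epsilon> A B C P \<le> 2 ^ card P"
      using P by (simp add: num_similar_def card_Pow)
  qed
qed simp

lemma h_max_set_nonempty: "{num_similar \<epsilon> A B C P | P. finite P \<and> card P = n} \<noteq> {}"
proof -
  have "infinite (UNIV :: (real^2) set)"
    using finite_imp_bounded not_bounded_UNIV by blast
  then obtain P :: "(real^2) set" where "finite P" "card P = n"
    using infinite_arbitrarily_large by blast
  then show ?thesis by blast
qed

end

theory Submission
  imports Defs
begin

text \<open>
The upper bound combines a symmetrisation with a geometric lemma; the lower bound is the recursive
construction that the definition of \<open>h_seq\<close> suggests. The threshold is one degree.

Call a triple an edge if it is \<open>\<epsilon>\<close>-similar to the equilateral triangle. Give the points weights,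
thought of as the sizes of clusters that replace them, and credit each cluster with \<open>h_seq\<close> of its
size. If two points lie in no common edge, the value is linear in their two weights apart from the
credits, and since \<open>h_seq\<close> is superadditive it does not decrease when all their weight is moved to
the better of the two. In this way (\<open>blowup_value_le\<close>) one arrives at a set in which every two
points lie in a common edge.

Such a covered set must look like the construction (\<open>covered_set_splits\<close>). Let two of its points
realise the diameter, normalised to 1, and complete them to a near-equilateral triangle. Take any point
\<open>s\<close> of the set, let \<open>p\<close> be the nearest vertex of this triangle and \<open>q, v\<close> the others. The pair \<open>s, v\<close> has
a third point \<open>t\<close>, obtained from \<open>s\<close> by a rotation through 60 degrees about \<open>v\<close>, and the same rotation
nearly takes one of \<open>p, q\<close> to the other. Because of this, the fact that \<open>t\<close> is within the diameter of
\<open>p\<close> or \<open>q\<close> becomes a relation between the squared distances of \<open>s\<close> from \<open>p, q, v\<close> alone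
(\<open>third_point\<close>). The two relations from \<open>v\<close> and \<open>q\<close> say, for exact triangles, that \<open>s = p\<close>; with the
tolerance they put \<open>s\<close> into a thin strip near \<open>p\<close>, and the triangle on \<open>s\<close> and \<open>p\<close>, contained in the
strip, is then small (\<open>vertex_cluster_small\<close>). So the set falls into three clusters, so well
separated that no edge has exactly two points in one of them. Counting edges inside the clusters by
induction and across them by the product of the weights reproduces the recursion.

The closed formula at powers of 3 is the equality case of \<open>24 h_seq n + n \<le> n\<^sup>3\<close>.
\<close>

section \<open>The sequence\<close>

lemma h_seq_small: "n < 3 \<Longrightarrow> h_seq n = 0"
  by (simp add: h_seq.simps)

lemma finite_splits:
  "finite {(a, b, c). a + b + c = n \<and> a < n \<and> b < n \<and> c < (n::nat)}"
  by (rule finite_subset[of _ "{..n} \<times> {..n} \<times> {..n}"]) auto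

text \<open>The recursion with the side conditions \<open>a, b, c < n\<close> and \<open>n \<ge> 3\<close> dropped: if one part is all of
\<open>n\<close>, both sides are \<open>h_seq n\<close>. With \<open>c = 0\<close> this says that two clusters may be merged into one
without loss, which is what the symmetrisation below relies on.\<close>

lemma h_seq_superadditive: "a * b * c + h_seq a + h_seq b + h_seq c \<le> h_seq (a + b + c)"
proof -
  consider "a + b + c < 3" | "a + b + c \<ge> 3" "a < a + b + c" "b < a + b + c" "c < a + b + c"
    | "b = 0" "c = 0" | "a = 0" "c = 0" | "a = 0" "b = 0"
    by linarith
  then show ?thesis
  proof cases
    case 1
    then have "a = 0 \<or> b = 0 \<or> c = 0" by linarith
    with 1 show ?thesis by (auto simp: h_seq_small)
  next
    case 2
    have "a * b * c + h_seq a + h_seq b + h_seq c \<le>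
      Max ((\<lambda>(a, b, c). a * b * c + h_seq a + h_seq b + h_seq c) `
             {(x, y, z). x + y + z = a + b + c \<and> x < a + b + c \<and> y < a + b + c \<and> z < a + b + c})"
      using 2 by (intro Max_ge finite_imageI finite_splits image_eqI[where x = "(a, b, c)"]) auto
    also have "\<dots> = h_seq (a + b + c)"
      using 2 by (subst (4) h_seq.simps) simp
    finally show ?thesis .
  qed (simp_all add: h_seq_small)
qed

lemma h_seq_split:
  assumes "n \<ge> 3"
  obtains a b c where "a + b + c = n" "a < n" "b < n" "c < n"
    "h_seq n = a * b * c + h_seq a + h_seq b + h_seq c"
proof -
  let ?f = "\<lambda>(a, b, c). a * b * c + h_seq a + h_seq b + h_seq c"
  let ?A = "{(a, b, c). a + b + c = n \<and> a < n \<and> b < n \<and> c < n}"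
  have "(1, 1, n - 2) \<in> ?A" using assms by auto
  then have "?A \<noteq> {}" by blast
  moreover have "h_seq n = Max (?f ` ?A)"
    using assms by (subst h_seq.simps) simp
  ultimately have "h_seq n \<in> ?f ` ?A"
    by (metis (no_types, lifting) Max_in finite_imageI finite_splits image_is_empty)
  then show thesis using that by auto
qed

text \<open>By induction this reduces to \<open>24 a b c + a\<^sup>3 + b\<^sup>3 + c\<^sup>3 \<le> (a + b + c)\<^sup>3\<close>, which is
the inequality of arithmetic and geometric means in the form \<open>8 a b c \<le> (a + b) (b + c) (c + a)\<close>.\<close>

lemma h_seq_upper: "24 * h_seq n + n \<le> n ^ 3"
proof (induction n rule: less_induct)
  case (less n)
  show ?case
  proof (cases "n < 3")
    case True
    then have "n = 0 \<or> n = 1 \<or> n = 2" by linarith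
    then show ?thesis by (auto simp: h_seq_small)
  next
    case False
    then obtain a b c where *: "a + b + c = n" "a < n" "b < n" "c < n"
      "h_seq n = a * b * c + h_seq a + h_seq b + h_seq c"
      by (metis h_seq_split not_less)
    \<comment> \<open>This sum of squares is \<open>(a + b) (b + c) (c + a) - 8 a b c\<close>.\<close>
    have "0 \<le> int a * (int b - int c)^2 + int b * (int c - int a)^2 + int c * (int a - int b)^2"
      by simp
    then have "24 * (int a * b * c) + int a ^ 3 + int b ^ 3 + int c ^ 3 \<le> (int a + b + c) ^ 3"
      by (simp add: power2_eq_square power3_eq_cube algebra_simps)
    then have "int (24 * (a * b * c) + a ^ 3 + b ^ 3 + c ^ 3) \<le> int ((a + b + c) ^ 3)"
      by simp
    then have "24 * (a * b * c) + a ^ 3 + b ^ 3 + c ^ 3 \<le> n ^ 3"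
      using *(1) by (simp only: of_nat_le_iff)
    with less.IH[OF *(2)] less.IH[OF *(3)] less.IH[OF *(4)] *(1,5) show ?thesis
      by (simp add: algebra_simps)
  qed
qed

text \<open>Equal parts \<open>a = b = c\<close> give equality in the previous bound, and a power of 3 can be split
equally all the way down to 1.\<close>

lemma h_seq_power_of_3: "24 * h_seq (3 ^ k) + 3 ^ k = (3 ^ k) ^ 3"
proof (induction k)
  case 0
  show ?case by (simp add: h_seq_small)
next
  case (Suc k)
  define n where "n = (3 ^ k :: nat)"
  have "n * n * n + h_seq n + h_seq n + h_seq n \<le> h_seq (n + n + n)"
    by (rule h_seq_superadditive)
  also have "n + n + n = 3 * n" by simp
  finally have "24 * n ^ 3 + 3 * (24 * h_seq n) \<le> 24 * h_seq (3 * n)"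
    unfolding power3_eq_cube by linarith
  moreover have "24 * h_seq n + n = n ^ 3"
    using Suc.IH by (simp add: n_def)
  moreover have "(3 * n) ^ 3 = 27 * n ^ 3"
    by (simp add: power_mult_distrib)
  ultimately have "(3 * n) ^ 3 \<le> 24 * h_seq (3 * n) + 3 * n"
    by linarith
  with h_seq_upper[of "3 * n"] show ?case by (simp add: n_def)
qed


section \<open>Weighted triple systems and symmetrisation\<close>

definition edge_weight :: "'a set set \<Rightarrow> ('a \<Rightarrow> nat) \<Rightarrow> 'a set \<Rightarrow> nat" where
  "edge_weight E w S = (\<Sum>t | t \<in> E \<and> t \<subseteq> S. \<Prod>x\<in>t. w x)"

text \<open>Replace each point \<open>x\<close> by a cluster of \<open>w x\<close> points. An edge of \<open>E\<close> then produces as many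
triples as the product of its weights, and each cluster is credited with \<open>h_seq\<close> of its
size, the number of triples it is going to contain. The value of \<open>P\<close> with all weights 1 is just
its number of edges, because \<open>h_seq 1 = 0\<close>.\<close>

definition blowup_value :: "'a set set \<Rightarrow> ('a \<Rightarrow> nat) \<Rightarrow> 'a set \<Rightarrow> nat" where
  "blowup_value E w S = edge_weight E w S + (\<Sum>x\<in>S. h_seq (w x))"

lemma finite_edges_within: "finite S \<Longrightarrow> finite {t. t \<in> E \<and> t \<subseteq> S \<and> Q t}"
  by (rule finite_subset[of _ "Pow S"]) auto

definition link_weight :: "'a set set \<Rightarrow> ('a \<Rightarrow> nat) \<Rightarrow> 'a set \<Rightarrow> 'a \<Rightarrow> nat" where
  "link_weight E w S x = (\<Sum>t | t \<in> E \<and> t \<subseteq> S \<and> x \<in> t. \<Prod>u\<in>t - {x}. w u)"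

lemma edge_weight_remove:
  assumes "finite S" "x \<in> S"
  shows "edge_weight E w S = edge_weight E w (S - {x}) + w x * link_weight E w S x"
proof -
  have "{t. t \<in> E \<and> t \<subseteq> S} = {t. t \<in> E \<and> t \<subseteq> S - {x}} \<union> {t. t \<in> E \<and> t \<subseteq> S \<and> x \<in> t}"
    by blast
  then have "edge_weight E w S = edge_weight E w (S - {x})
      + (\<Sum>t | t \<in> E \<and> t \<subseteq> S \<and> x \<in> t. \<Prod>u\<in>t. w u)"
    unfolding edge_weight_def
    using sum.union_disjoint[of "{t. t \<in> E \<and> t \<subseteq> S - {x}}" "{t. t \<in> E \<and> t \<subseteq> S \<and> x \<in> t}"
        "\<lambda>t. \<Prod>u\<in>t. w u"] finite_edges_within[of "S - {x}" E "\<lambda>_. True"] finite_edges_within[of S E "\<lambda>t. x \<in> t"] assms(1)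
    by auto
  moreover have "(\<Sum>t | t \<in> E \<and> t \<subseteq> S \<and> x \<in> t. \<Prod>u\<in>t. w u) = w x * link_weight E w S x"
    unfolding link_weight_def sum_distrib_left
    by (intro sum.cong refl prod.remove) (auto intro: finite_subset[OF _ assms(1)])
  ultimately show ?thesis by simp
qed

lemma edge_weight_cong: "(\<And>x. x \<in> S \<Longrightarrow> w x = w' x) \<Longrightarrow> edge_weight E w S = edge_weight E w' S"
  unfolding edge_weight_def by (intro sum.cong refl prod.cong) auto

text \<open>Symmetrisation. If no edge contains both \<open>x\<close> and \<open>y\<close>, the edge weight is linear in
\<open>(w x, w y)\<close> with the link weights as coefficients. So the mass of \<open>y\<close> may be moved to \<open>x\<close> when
the link of \<open>x\<close> is at least as heavy, and superadditivity of \<open>h_seq\<close> takes care of the clusters.\<close>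

lemma blowup_value_merge:
  assumes "finite S" "x \<in> S" "y \<in> S" "x \<noteq> y"
    and uncovered: "\<And>t. t \<in> E \<Longrightarrow> t \<subseteq> S \<Longrightarrow> x \<in> t \<Longrightarrow> y \<notin> t"
    and le: "link_weight E w S y \<le> link_weight E w S x"
  shows "blowup_value E w S \<le> blowup_value E (w(x := w x + w y)) (S - {y})"
proof -
  let ?w = "w(x := w x + w y)" and ?R = "S - {y} - {x}"
  have link_x: "link_weight E w (S - {y}) x = link_weight E w S x"
    unfolding link_weight_def using uncovered by (intro sum.cong) auto
  have link_x': "link_weight E ?w (S - {y}) x = link_weight E w (S - {y}) x"
    unfolding link_weight_def by (intro sum.cong refl prod.cong) auto
  have "edge_weight E w S = edge_weight E w (S - {y}) + w y * link_weight E w S y"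
    using assms by (intro edge_weight_remove) auto
  also have "edge_weight E w (S - {y}) = edge_weight E w ?R + w x * link_weight E w S x"
    using edge_weight_remove[of "S - {y}" x E w] assms link_x by simp
  also have "edge_weight E w ?R + w x * link_weight E w S x + w y * link_weight E w S y
      \<le> edge_weight E w ?R + (w x + w y) * link_weight E w S x"
    using le by (simp add: algebra_simps)
  also have "\<dots> = edge_weight E ?w (S - {y})"
    using edge_weight_remove[of "S - {y}" x E ?w] assms link_x link_x'
      edge_weight_cong[of ?R w ?w E] by simp
  finally have 1: "edge_weight E w S \<le> edge_weight E ?w (S - {y})" .
  have "(\<Sum>u\<in>S. h_seq (w u)) = h_seq (w x) + h_seq (w y) + (\<Sum>u\<in>?R. h_seq (w u))"
    using assms by (simp add: sum.remove[of S y] sum.remove[of "S - {y}" x])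
  also have "\<dots> \<le> h_seq (w x + w y) + (\<Sum>u\<in>?R. h_seq (w u))"
    using h_seq_superadditive[of "w x" "w y" 0] by simp
  also have "\<dots> = (\<Sum>u\<in>S - {y}. h_seq (?w u))"
    using assms by (simp add: sum.remove[of "S - {y}" x])
  finally show ?thesis using 1 unfolding blowup_value_def by linarith
qed

lemma inj_on_unordered_triple:
  assumes "X \<inter> Y = {}" "Y \<inter> Z = {}" "X \<inter> Z = {}"
  shows "inj_on (\<lambda>(x, y, z). {x, y, z}) (X \<times> Y \<times> Z)"
proof (rule inj_onI)
  let ?g = "\<lambda>(x, y, z). {x, y, z}"
  fix u u' assume u: "u \<in> X \<times> Y \<times> Z" "u' \<in> X \<times> Y \<times> Z" "?g u = ?g u'"
  obtain x y z x' y' z' where xyz: "u = (x, y, z)" "u' = (x', y', z')"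
    by (metis prod_cases3)
  with u have "x \<in> {x', y', z'}" "y \<in> {x', y', z'}" "z \<in> {x', y', z'}" by auto
  with u xyz assms show "u = u'" by auto
qed

text \<open>Expanding the product of the three class weights gives one term for each choice of a point in
each class, and distinct rainbow edges come from distinct choices.\<close>

lemma transversal_weight_le:
  fixes w :: "'a \<Rightarrow> nat"
  assumes "finite S"
  shows "(\<Sum>t | t \<in> E \<and> t \<subseteq> S \<and> (\<exists>x y z. t = {x, y, z} \<and> c x = (0::nat) \<and> c y = 1 \<and> c z = 2).
            \<Prod>x\<in>t. w x)
      \<le> (\<Sum>x | x \<in> S \<and> c x = 0. w x) * (\<Sum>x | x \<in> S \<and> c x = 1. w x) * (\<Sum>x | x \<in> S \<and> c x = 2. w x)"
    (is "sum ?p ?T \<le> sum w ?A * sum w ?B * sum w ?C")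
proof -
  let ?g = "\<lambda>(x, y, z). {x, y, z}"
  have inj: "inj_on ?g (?A \<times> ?B \<times> ?C)"
    by (rule inj_on_unordered_triple) auto
  have "sum ?p ?T \<le> sum ?p (?g ` (?A \<times> ?B \<times> ?C))"
  proof (rule sum_mono2)
    show "?T \<subseteq> ?g ` (?A \<times> ?B \<times> ?C)"
    proof clarify
      fix x y z assume "{x, y, z} \<subseteq> S" "c x = 0" "c y = 1" "c z = 2"
      then show "{x, y, z} \<in> ?g ` (?A \<times> ?B \<times> ?C)"
        by (intro image_eqI[where x = "(x, y, z)"]) auto
    qed
  qed (use assms in auto)
  also have "\<dots> = (\<Sum>p\<in>?A \<times> ?B \<times> ?C. ?p (?g p))"
    by (subst sum.reindex[OF inj]) (simp add: o_def)
  also have "\<dots> = (\<Sum>(x, y, z)\<in>?A \<times> ?B \<times> ?C. w x * w y * w z)"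
  proof (intro sum.cong refl, clarify)
    fix x y z assume c: "c x = 0" "c y = 1" "c z = 2"
    then have "x \<noteq> y" "y \<noteq> z" "x \<noteq> z" by auto
    then show "?p {x, y, z} = w x * w y * w z" by simp
  qed
  also have "\<dots> = sum w ?A * sum w ?B * sum w ?C"
    by (simp add: sum.cartesian_product[symmetric] sum_distrib_left[symmetric] sum_distrib_right[symmetric])
  finally show ?thesis .
qed

text \<open>A 3-colouring of \<open>S\<close>, not constant on \<open>S\<close>, such that each edge is monochromatic or
rainbow: the shape of the configurations that the recursion for \<open>h_seq\<close> describes.\<close>

definition splitting :: "'a set set \<Rightarrow> 'a set \<Rightarrow> ('a \<Rightarrow> nat) \<Rightarrow> bool" where
  "splitting E S c \<longleftrightarrow> (\<forall>x\<in>S. c x < 3) \<and> (\<exists>x\<in>S. \<exists>y\<in>S. c x \<noteq> c y) \<and>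
     (\<forall>t\<in>E. t \<subseteq> S \<longrightarrow> (\<exists>i. \<forall>x\<in>t. c x = i) \<or> inj_on c t)"

lemma sum_Un_le:
  fixes f :: "'a \<Rightarrow> nat"
  assumes "finite A" "finite B"
  shows "sum f (A \<union> B) \<le> sum f A + sum f B"
  using sum.union_inter[OF assms, of f] by linarith

lemma rainbow_triple:
  assumes "card t = 3" "inj_on c t" "\<And>x. x \<in> t \<Longrightarrow> c x < (3::nat)"
  obtains x y z where "t = {x, y, z}" "c x = 0" "c y = 1" "c z = 2"
proof -
  have "finite t" using assms(1) by (simp add: card_ge_0_finite)
  have "card (c ` t) = 3" using assms by (simp add: card_image)
  moreover have "c ` t \<subseteq> {..<3}" using assms by auto
  ultimately have img: "c ` t = {..<3}" by (intro card_subset_eq) auto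
  have "0 \<in> c ` t" "1 \<in> c ` t" "2 \<in> c ` t" by (simp_all add: img)
  then obtain x y z where xyz: "x \<in> t" "y \<in> t" "z \<in> t" "c x = 0" "c y = 1" "c z = 2"
    by auto
  then have "x \<noteq> y" "y \<noteq> z" "x \<noteq> z" by auto
  then have "card {x, y, z} = 3" by simp
  then have "{x, y, z} = t"
    using xyz \<open>finite t\<close> assms(1) by (intro card_subset_eq) auto
  with xyz that show thesis by metis
qed

text \<open>The monochromatic edges are counted by the induction hypothesis for the colour classes, the
rainbow ones number at most the product of the class weights; this is one step of the recursion.\<close>

lemma blowup_value_split:
  assumes fin: "finite S" and E3: "\<And>t. t \<in> E \<Longrightarrow> card t = 3"
    and sp: "splitting E S c"
    and IH: "\<And>i. blowup_value E w {x \<in> S. c x = i} \<le> h_seq (\<Sum>x | x \<in> S \<and> c x = i. w x)"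
  shows "blowup_value E w S \<le> h_seq (\<Sum>x\<in>S. w x)"
proof -
  let ?S = "\<lambda>i. {x \<in> S. c x = i}"
  let ?T = "{t. t \<in> E \<and> t \<subseteq> S \<and> (\<exists>x y z. t = {x, y, z} \<and> c x = 0 \<and> c y = 1 \<and> c z = 2)}"
  let ?p = "\<lambda>t. \<Prod>x\<in>t. w x"
  have c3: "c x < 3" if "x \<in> S" for x using sp that by (auto simp: splitting_def)
  have S: "S = ?S 0 \<union> ?S 1 \<union> ?S 2" using c3 by force
  have part: "sum f S = sum f (?S 0) + sum f (?S 1) + sum f (?S 2)" for f :: "'a \<Rightarrow> nat"
  proof -
    have "sum f S = sum f (?S 0 \<union> ?S 1 \<union> ?S 2)" using S by simp
    also have "\<dots> = sum f (?S 0 \<union> ?S 1) + sum f (?S 2)"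
      by (rule sum.union_disjoint) (use fin in auto)
    also have "sum f (?S 0 \<union> ?S 1) = sum f (?S 0) + sum f (?S 1)"
      by (rule sum.union_disjoint) (use fin in auto)
    finally show ?thesis .
  qed
  let ?I = "\<lambda>i. {t. t \<in> E \<and> t \<subseteq> ?S i}"
  have fin_I: "finite (?I i)" for i
    using finite_edges_within[of "?S i" E "\<lambda>_. True"] fin by simp
  have fin_T: "finite ?T"
    using fin by (rule finite_edges_within)
  have "{t. t \<in> E \<and> t \<subseteq> S} \<subseteq> (?I 0 \<union> ?I 1) \<union> (?I 2 \<union> ?T)"
  proof
    fix t assume "t \<in> {t. t \<in> E \<and> t \<subseteq> S}"
    then have t: "t \<in> E" "t \<subseteq> S" by auto
    then consider i where "\<forall>x\<in>t. c x = i" | "inj_on c t"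
      using sp unfolding splitting_def by blast
    then show "t \<in> (?I 0 \<union> ?I 1) \<union> (?I 2 \<union> ?T)"
    proof cases
      case 1
      have "t \<noteq> {}" using E3[OF t(1)] card.empty by (metis zero_neq_numeral)
      then obtain x where "x \<in> t" by blast
      then have "i < 3" using 1 c3[of x] t(2) by (metis subsetD)
      then have "i = 0 \<or> i = 1 \<or> i = 2" by linarith
      moreover have "t \<in> ?I i" using 1 t by blast
      ultimately show ?thesis by blast
    next
      case 2
      obtain x y z where "t = {x, y, z}" "c x = 0" "c y = 1" "c z = 2"
        using rainbow_triple[OF E3[OF t(1)] 2] c3 t(2) by (metis subsetD)
      with t have "t \<in> ?T" by blast
      then show ?thesis by blast
    qed
  qed
  then have "edge_weight E w S \<le> sum ?p ((?I 0 \<union> ?I 1) \<union> (?I 2 \<union> ?T))"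
    unfolding edge_weight_def
    by (rule sum_mono2[rotated]) (simp_all only: finite_Un fin_I fin_T simp_thms le0)
  also have "\<dots> \<le> sum ?p (?I 0 \<union> ?I 1) + sum ?p (?I 2 \<union> ?T)"
    by (rule sum_Un_le) (simp_all only: finite_Un fin_I fin_T simp_thms)
  also have "\<dots> \<le> (sum ?p (?I 0) + sum ?p (?I 1)) + (sum ?p (?I 2) + sum ?p ?T)"
    by (rule add_mono; rule sum_Un_le; rule fin_I fin_T)
  also have "\<dots> \<le> edge_weight E w (?S 0) + edge_weight E w (?S 1) + edge_weight E w (?S 2)
      + sum w (?S 0) * sum w (?S 1) * sum w (?S 2)"
    using transversal_weight_le[OF fin, where E = E and c = c and w = w]
    unfolding edge_weight_def by linarith
  finally have "blowup_value E w S \<le> blowup_value E w (?S 0) + blowup_value E w (?S 1)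
      + blowup_value E w (?S 2) + sum w (?S 0) * sum w (?S 1) * sum w (?S 2)"
    unfolding blowup_value_def part[of "\<lambda>x. h_seq (w x)"] by linarith
  also have "\<dots> \<le> h_seq (sum w (?S 0)) + h_seq (sum w (?S 1)) + h_seq (sum w (?S 2))
      + sum w (?S 0) * sum w (?S 1) * sum w (?S 2)"
    by (intro add_mono IH order_refl)
  also have "\<dots> \<le> h_seq (sum w S)"
    using h_seq_superadditive[of "sum w (?S 0)" "sum w (?S 1)" "sum w (?S 2)"]
    unfolding part[of w] by linarith
  finally show ?thesis .
qed

text \<open>Induction on the number of points. A pair in no common edge allows a merge, which removes a point.
If every pair lies in an edge, the assumption provides a splitting, whose classes are smaller.\<close>

theorem blowup_value_le:
  fixes E :: "'a set set"
  assumes E3: "\<And>t. t \<in> E \<Longrightarrow> card t = 3"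
    and split: "\<And>S. finite S \<Longrightarrow> 2 \<le> card S \<Longrightarrow>
        (\<And>x y. x \<in> S \<Longrightarrow> y \<in> S \<Longrightarrow> x \<noteq> y \<Longrightarrow> \<exists>t\<in>E. t \<subseteq> S \<and> x \<in> t \<and> y \<in> t) \<Longrightarrow>
        \<exists>c. splitting E S c"
    and "finite S"
  shows "blowup_value E w S \<le> h_seq (\<Sum>x\<in>S. w x)"
  using \<open>finite S\<close>
proof (induction "card S" arbitrary: S w rule: less_induct)
  case less
  show ?case
  proof (cases "card S < 2")
    case True
    have "card t \<noteq> 3" if "t \<subseteq> S" for t
      using card_mono[OF less.prems that] True by linarith
    then have "{t. t \<in> E \<and> t \<subseteq> S} = {}" using E3 by blast
    then have 0: "edge_weight E w S = 0" unfolding edge_weight_def by (simp only: sum.empty)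
    from True have "card S = 0 \<or> card S = 1" by linarith
    then have "S = {} \<or> (\<exists>x. S = {x})"
      using less.prems by (auto simp: card_1_singleton_iff)
    then show ?thesis using 0 by (auto simp: blowup_value_def)
  next
    case False
    show ?thesis
    proof (cases "\<forall>x\<in>S. \<forall>y\<in>S. x \<noteq> y \<longrightarrow> (\<exists>t\<in>E. t \<subseteq> S \<and> x \<in> t \<and> y \<in> t)")
      case True
      have "\<exists>c. splitting E S c"
        using split[OF less.prems] False True by (simp only: not_less) blast
      then obtain c where c: "splitting E S c" ..
      show ?thesis
      proof (rule blowup_value_split[OF less.prems E3 c])
        fix i
        from c obtain x y where "x \<in> S" "y \<in> S" "c x \<noteq> c y"
          unfolding splitting_def by blast
        then have "x \<notin> {x \<in> S. c x = i} \<or> y \<notin> {x \<in> S. c x = i}" by simp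
        with \<open>x \<in> S\<close> \<open>y \<in> S\<close> have "{x \<in> S. c x = i} \<subset> S" by blast
        then have "card {x \<in> S. c x = i} < card S" using less.prems by (rule psubset_card_mono[rotated])
        then show "blowup_value E w {x \<in> S. c x = i} \<le> h_seq (\<Sum>x | x \<in> S \<and> c x = i. w x)"
          by (rule less.hyps) (use less.prems in simp)
      qed
    next
      case False
      have *: "blowup_value E w S \<le> h_seq (sum w S)"
        if xy: "x \<in> S" "y \<in> S" "x \<noteq> y" "\<And>t. t \<in> E \<Longrightarrow> t \<subseteq> S \<Longrightarrow> x \<in> t \<Longrightarrow> y \<notin> t"
          and le: "link_weight E w S y \<le> link_weight E w S x" for x y
      proof -
        let ?w = "w(x := w x + w y)"
        have "blowup_value E w S \<le> blowup_value E ?w (S - {y})"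
          by (rule blowup_value_merge[OF less.prems xy le])
        also have "\<dots> \<le> h_seq (sum ?w (S - {y}))"
        proof (rule less.hyps)
          show "card (S - {y}) < card S" using less.prems xy(2) by (rule card_Diff1_less)
          show "finite (S - {y})" using less.prems by simp
        qed
        also have "sum ?w (S - {y}) = sum w S"
          using xy(1-3) less.prems by (simp add: sum.remove[of S y] sum.remove[of "S - {y}" x])
        finally show ?thesis .
      qed
      from False obtain x y where xy: "x \<in> S" "y \<in> S" "x \<noteq> y"
        and uncov: "\<not> (\<exists>t\<in>E. t \<subseteq> S \<and> x \<in> t \<and> y \<in> t)" by blast
      show ?thesis
      proof (cases "link_weight E w S y \<le> link_weight E w S x")
        case True
        show ?thesis by (rule *[OF xy _ True]) (use uncov in blast)
      next
        case False
        then have le: "link_weight E w S x \<le> link_weight E w S y" by simp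
        show ?thesis by (rule *[OF xy(2,1) xy(3)[symmetric] _ le]) (use uncov in blast)
      qed
    qed
  qed
qed

corollary card_edges_le_h_seq:
  fixes E :: "'a set set"
  assumes "\<And>t. t \<in> E \<Longrightarrow> card t = 3"
    and "\<And>S. finite S \<Longrightarrow> 2 \<le> card S \<Longrightarrow>
        (\<And>x y. x \<in> S \<Longrightarrow> y \<in> S \<Longrightarrow> x \<noteq> y \<Longrightarrow> \<exists>t\<in>E. t \<subseteq> S \<and> x \<in> t \<and> y \<in> t) \<Longrightarrow>
        \<exists>c. splitting E S c"
    and "finite P"
  shows "card {t \<in> E. t \<subseteq> P} \<le> h_seq (card P)"
proof -
  have "blowup_value E (\<lambda>_. 1) P \<le> h_seq (\<Sum>x\<in>P. 1)"
    by (rule blowup_value_le[OF assms])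
  then show ?thesis
    by (simp add: blowup_value_def edge_weight_def h_seq_small)
qed

section \<open>Near-equilateral triangles in the complex plane\<close>

text \<open>Tolerances are expressed through squared side lengths, which are polynomial in the
coordinates; \<open>21/500\<close> is what an angle tolerance of one degree amounts to. The points are complex
numbers so that rotations are multiplications.\<close>

definition near_equilateral :: "complex \<Rightarrow> complex \<Rightarrow> complex \<Rightarrow> bool" where
  "near_equilateral x y z \<longleftrightarrow>
     \<bar>(dist x y)\<^sup>2 - (dist x z)\<^sup>2\<bar> \<le> 21/500 * (dist y z)\<^sup>2 \<and>
     \<bar>(dist x y)\<^sup>2 - (dist y z)\<^sup>2\<bar> \<le> 21/500 * (dist x z)\<^sup>2 \<and>
     \<bar>(dist x z)\<^sup>2 - (dist y z)\<^sup>2\<bar> \<le> 21/500 * (dist x y)\<^sup>2"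

lemma near_equilateral_rotate: "near_equilateral x y z \<Longrightarrow> near_equilateral y z x"
  unfolding near_equilateral_def by (auto simp: dist_commute abs_minus_commute)

lemma near_equilateral_swap: "near_equilateral x y z \<Longrightarrow> near_equilateral y x z"
  unfolding near_equilateral_def by (auto simp: dist_commute abs_minus_commute)

lemma near_equilateral_divide:
  assumes "near_equilateral x y z"
  shows "near_equilateral (x / c) (y / c) (z / c)"
proof -
  have d: "dist (u / c) (v / c) = dist u v / cmod c" for u v
    by (simp add: dist_norm norm_divide flip: diff_divide_distrib)
  have "\<bar>(a / m)\<^sup>2 - (b / m)\<^sup>2\<bar> \<le> 21/500 * (e / m)\<^sup>2" if "\<bar>a\<^sup>2 - b\<^sup>2\<bar> \<le> 21/500 * e\<^sup>2" for a b e m :: real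
  proof -
    have "\<bar>a\<^sup>2 - b\<^sup>2\<bar> / m\<^sup>2 \<le> (21/500 * e\<^sup>2) / m\<^sup>2" using that by (intro divide_right_mono) auto
    then show ?thesis by (simp add: power_divide flip: diff_divide_distrib)
  qed
  with assms show ?thesis unfolding near_equilateral_def d by blast
qed

lemma near_equilateral_ratio:
  assumes "near_equilateral x y z"
  shows "(dist x y)\<^sup>2 \<le> (261/250) * (dist x z)\<^sup>2" "(239/250) * (dist x z)\<^sup>2 \<le> (dist x y)\<^sup>2"
proof -
  define A B C where "A = (dist x y)\<^sup>2" "B = (dist x z)\<^sup>2" "C = (dist y z)\<^sup>2"
  have "\<bar>A - B\<bar> \<le> 21/500 * C" "\<bar>A - C\<bar> \<le> 21/500 * B" "\<bar>B - C\<bar> \<le> 21/500 * A" "A \<ge> 0" "B \<ge> 0" "C \<ge> 0"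
    using assms by (simp_all add: near_equilateral_def A_B_C_def)
  then have "A \<le> (261/250) * B" "(239/250) * B \<le> A" by linarith+
  then show "(dist x y)\<^sup>2 \<le> (261/250) * (dist x z)\<^sup>2" "(239/250) * (dist x z)\<^sup>2 \<le> (dist x y)\<^sup>2"
    by (simp_all add: A_B_C_def)
qed

lemma sq_dist: "(dist x y)\<^sup>2 = (Re x - Re y)\<^sup>2 + (Im x - Im y)\<^sup>2"
  by (simp add: dist_norm cmod_power2)

text \<open>The form is half of \<open>a\<^sup>2 + b\<^sup>2 + (a - b)\<^sup>2\<close>. Among \<open>a\<close>, \<open>-b\<close> and \<open>b - a\<close>, which sum to 0, two have the
same sign and the third is minus their sum, so the three squares add up to at most twice the largest.\<close>

lemma sum_squares_three_le:
  fixes a b K :: real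
  assumes "\<bar>a\<bar> \<le> K" "\<bar>b\<bar> \<le> K" "\<bar>a - b\<bar> \<le> K"
  shows "a\<^sup>2 + b\<^sup>2 - a * b \<le> K\<^sup>2"
proof -
  have *: "a\<^sup>2 + b\<^sup>2 - a * b \<le> K\<^sup>2" if "\<bar>a\<bar> \<le> K" "\<bar>b\<bar> \<le> K" "\<bar>a - b\<bar> \<le> K" "a \<ge> 0" for a b :: real
  proof -
    consider "b \<le> 0" | "0 \<le> b" "b \<le> a" | "a \<le> b" by linarith
    then show ?thesis
    proof cases
      case 1
      then have "a * b \<le> 0" using that by (simp add: mult_nonneg_nonpos)
      moreover have "(a - b)\<^sup>2 \<le> K\<^sup>2" using that by (intro power2_le_iff_abs_le[THEN iffD2]) auto
      ultimately show ?thesis by (simp add: power2_diff)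
    next
      case 2
      then have "b * b \<le> a * b" by (intro mult_right_mono)
      moreover have "a\<^sup>2 \<le> K\<^sup>2" using that by (intro power_mono) auto
      ultimately show ?thesis by (simp add: power2_eq_square)
    next
      case 3
      then have "a * a \<le> a * b" using that by (intro mult_left_mono)
      moreover have "b\<^sup>2 \<le> K\<^sup>2" using 3 that by (intro power_mono) auto
      ultimately show ?thesis by (simp add: power2_eq_square)
    qed
  qed
  show ?thesis
    using *[of a b] *[of "-a" "-b"] assms by (cases "a \<ge> 0") auto
qed

definition rot60 :: complex where "rot60 = Complex (1/2) (sqrt 3 / 2)"

text \<open>The apex of a near-equilateral triangle with base from 0 to 1 is close to a primitive sixth root of
unity. For \<open>\<omega>\<close> such a root, \<open>|M - \<omega>| |M - cnj \<omega>| = |M\<^sup>2 - M + 1|\<close>, whose square is the quadratic form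
\<open>(a - 1)\<^sup>2 + (b - 1)\<^sup>2 - (a - 1) (b - 1)\<close> in the squared sides \<open>a, b\<close>. It is small, while the
factor belonging to the root in the other half plane is about \<open>sqrt 3\<close>.\<close>

lemma apex_ratio_upper:
  assumes "Im M \<ge> 0"
    and a: "\<bar>(cmod M)\<^sup>2 - 1\<bar> \<le> 21/500 * (cmod (M - 1))\<^sup>2"
    and b: "\<bar>(cmod (M - 1))\<^sup>2 - 1\<bar> \<le> 21/500 * (cmod M)\<^sup>2"
    and ab: "\<bar>(cmod M)\<^sup>2 - (cmod (M - 1))\<^sup>2\<bar> \<le> 21/500"
  shows "cmod (M - rot60) \<le> (13/500)"
proof -
  define x y where "x = Re M" "y = Im M"
  define a b where "a = (cmod M)\<^sup>2" "b = (cmod (M - 1))\<^sup>2"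
  have ax: "a = x\<^sup>2 + y\<^sup>2" and bx: "b = (x - 1)\<^sup>2 + y\<^sup>2"
    by (simp_all add: a_b_def x_y_def cmod_power2)
  have bnds: "\<bar>a - 1\<bar> \<le> 21/500 * b" "\<bar>b - 1\<bar> \<le> 21/500 * a" "\<bar>a - b\<bar> \<le> 21/500"
    using assms by (simp_all add: a_b_def)
  have "a \<ge> 0" "b \<ge> 0" by (simp_all add: a_b_def)
  with bnds have ab': "a \<le> (261/250)" "b \<le> (261/250)" "a \<ge> (239/250)" "b \<ge> (239/250)" by linarith+
  have x: "x = (1 + a - b) / 2" using ax bx by (simp add: power2_eq_square algebra_simps)
  have "0 \<le> x" "x \<le> (521/1000)" using x bnds(3)[unfolded abs_le_iff] by simp_all
  then have "x\<^sup>2 \<le> (521/1000)\<^sup>2" by (intro power_mono) auto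
  with ax ab' have y2: "y\<^sup>2 \<ge> (1369/2000)" by (simp add: power2_eq_square)
  have y: "y \<ge> (827/1000)"
  proof (rule power2_le_imp_le)
    show "(827/1000)\<^sup>2 \<le> y\<^sup>2" using y2 by (simp add: power2_eq_square)
  qed (use assms in \<open>simp add: x_y_def\<close>)
  define s where "s = sqrt 3"
  have s: "s\<^sup>2 = 3" "s \<ge> 0" by (simp_all add: s_def)
  have s': "s \<ge> (433/250)" by (rule power2_le_imp_le) (use s in \<open>simp_all add: power2_eq_square\<close>)
  have K: "\<bar>a - 1\<bar> \<le> (877/20000)" "\<bar>b - 1\<bar> \<le> (877/20000)" "\<bar>(a - 1) - (b - 1)\<bar> \<le> (877/20000)"
    using bnds ab' by linarith+
  have D: "(cmod (M - rot60))\<^sup>2 = (x - 1/2)\<^sup>2 + (y - s/2)\<^sup>2"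
    by (simp add: cmod_power2 rot60_def x_y_def s_def)
  have "((x - 1/2)\<^sup>2 + (y - s/2)\<^sup>2) * ((x - 1/2)\<^sup>2 + (y + s/2)\<^sup>2)
      = (a - 1)\<^sup>2 + (b - 1)\<^sup>2 - (a - 1) * (b - 1)"
  proof -
    have y4: "(y - s/2)\<^sup>2 = y\<^sup>2 - y * s + 3/4" "(y + s/2)\<^sup>2 = y\<^sup>2 + y * s + 3/4"
      using s(1) by (simp_all add: power2_eq_square algebra_simps)
    have ys: "(y * s)\<^sup>2 = 3 * y\<^sup>2" by (simp add: power_mult_distrib s)
    have "((x - 1/2)\<^sup>2 + (y - s/2)\<^sup>2) * ((x - 1/2)\<^sup>2 + (y + s/2)\<^sup>2)
       = ((x - 1/2)\<^sup>2 + y\<^sup>2 + 3/4)\<^sup>2 - (y * s)\<^sup>2"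
      unfolding y4 by (simp add: power2_eq_square algebra_simps)
    also have "\<dots> = (a - 1)\<^sup>2 + (b - 1)\<^sup>2 - (a - 1) * (b - 1)"
      unfolding ys ax bx by (simp add: power2_eq_square field_simps)
    finally show ?thesis .
  qed
  also have "\<dots> \<le> (877/20000)\<^sup>2" using K by (rule sum_squares_three_le)
  finally have prod: "(cmod (M - rot60))\<^sup>2 * ((x - 1/2)\<^sup>2 + (y + s/2)\<^sup>2) \<le> (877/20000)\<^sup>2"
    unfolding D .
  have "(1693/1000)\<^sup>2 \<le> (y + s/2)\<^sup>2" using y s' by (intro power_mono) auto
  also have "\<dots> \<le> (x - 1/2)\<^sup>2 + (y + s/2)\<^sup>2" by simp
  finally have "(cmod (M - rot60))\<^sup>2 * (1693/1000)\<^sup>2 \<le> (cmod (M - rot60))\<^sup>2 * ((x - 1/2)\<^sup>2 + (y + s/2)\<^sup>2)"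
    by (intro mult_left_mono) auto
  with prod have "(cmod (M - rot60))\<^sup>2 * (1693/1000)\<^sup>2 \<le> (877/20000)\<^sup>2" by linarith
  then have "(cmod (M - rot60))\<^sup>2 \<le> (13/500)\<^sup>2" by (simp add: power2_eq_square)
  then show ?thesis by (rule power2_le_imp_le) auto
qed

lemma apex_ratio:
  assumes a: "\<bar>(cmod M)\<^sup>2 - 1\<bar> \<le> 21/500 * (cmod (M - 1))\<^sup>2"
    and b: "\<bar>(cmod (M - 1))\<^sup>2 - 1\<bar> \<le> 21/500 * (cmod M)\<^sup>2"
    and ab: "\<bar>(cmod M)\<^sup>2 - (cmod (M - 1))\<^sup>2\<bar> \<le> 21/500"
  shows "\<exists>\<omega>\<in>{rot60, cnj rot60}. cmod (M - \<omega>) \<le> (13/500)"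
proof (cases "Im M \<ge> 0")
  case True
  then show ?thesis using apex_ratio_upper[OF _ assms] by auto
next
  case False
  have "cmod (cnj M - 1) = cmod (M - 1)" "cmod (cnj M - rot60) = cmod (M - cnj rot60)"
    using complex_mod_cnj[of "M - 1"] complex_mod_cnj[of "M - cnj rot60"] by simp_all
  with apex_ratio_upper[of "cnj M"] assms False show ?thesis by auto
qed

lemma near_equilateral_rot60:
  assumes "near_equilateral v s t"
  shows "\<exists>\<omega>\<in>{rot60, cnj rot60}. cmod ((t - v) - \<omega> * (s - v)) \<le> (13/500) * cmod (s - v)"
proof (cases "s = v")
  case True
  with assms have "t = v" by (auto simp: near_equilateral_def)
  with True show ?thesis by auto
next
  case False
  define M where "M = (t - v) / (s - v)"
  have r: "(s - v) * M = t - v" using False by (simp add: M_def)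
  have pos: "cmod (s - v) ^ 2 > 0" using False by simp
  have d: "dist v s = cmod (s - v)" "dist v t = cmod (s - v) * cmod M"
    "dist s t = cmod (s - v) * cmod (M - 1)"
    unfolding norm_mult[symmetric] right_diff_distrib r
    by (simp_all add: dist_norm norm_minus_commute)
  note ne = assms[unfolded near_equilateral_def d power_mult_distrib]
  have c: "\<bar>x\<bar> \<le> k * y" if "\<bar>A * x\<bar> \<le> k * (A * y)" "A > 0" for A x y k :: real
    using that by (simp add: abs_mult mult.left_commute[of k])
  let ?A = "(cmod (s - v))\<^sup>2"
  have "\<exists>\<omega>\<in>{rot60, cnj rot60}. cmod (M - \<omega>) \<le> (13/500)"
  proof (rule apex_ratio)
    show "\<bar>(cmod M)\<^sup>2 - 1\<bar> \<le> 21/500 * (cmod (M - 1))\<^sup>2"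
      using c[OF _ pos, of "(cmod M)\<^sup>2 - 1" "21/500" "(cmod (M - 1))\<^sup>2"] ne
      by (simp add: right_diff_distrib abs_minus_commute)
    show "\<bar>(cmod (M - 1))\<^sup>2 - 1\<bar> \<le> 21/500 * (cmod M)\<^sup>2"
      using c[OF _ pos, of "(cmod (M - 1))\<^sup>2 - 1" "21/500" "(cmod M)\<^sup>2"] ne
      by (simp add: right_diff_distrib abs_minus_commute)
    show "\<bar>(cmod M)\<^sup>2 - (cmod (M - 1))\<^sup>2\<bar> \<le> 21/500"
      using c[OF _ pos, of "(cmod M)\<^sup>2 - (cmod (M - 1))\<^sup>2" "21/500" 1] ne
      by (simp add: right_diff_distrib)
  qed
  then obtain \<omega> where w: "\<omega> \<in> {rot60, cnj rot60}" "cmod (M - \<omega>) \<le> (13/500)" by blast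
  have "(t - v) - \<omega> * (s - v) = (M - \<omega>) * (s - v)" using r by (simp add: algebra_simps)
  then have "cmod ((t - v) - \<omega> * (s - v)) \<le> (13/500) * cmod (s - v)"
    using mult_right_mono[OF w(2) norm_ge_zero[of "s - v"]] by (simp add: norm_mult)
  with w(1) show ?thesis by blast
qed

text \<open>In the exact case \<open>Q = \<omega> P\<close> and \<open>\<tau> = \<omega> \<sigma>\<close> with \<open>|P| = 1\<close>, so
\<open>\<tau> \<bullet> P = \<sigma> \<bullet> (cnj \<omega> P) = \<sigma> \<bullet> (P - Q)\<close>. Hence \<open>|\<tau> - P| \<le> 1\<close>, a bound on the new point \<open>\<tau>\<close>,
turns into \<open>|\<sigma> - P|\<^sup>2 + |\<sigma>|\<^sup>2 \<le> |\<sigma> - Q|\<^sup>2\<close>, which no longer mentions \<open>\<tau>\<close>. The error \<open>0.19\<close> collects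
\<open>2 \<cdot> 0.042\<close> from the lengths and \<open>4 \<cdot> 0.026\<close> from the two rotations.\<close>

lemma third_point_core:
  fixes \<omega> P Q \<sigma> \<tau> :: complex
  assumes w: "\<omega> + cnj \<omega> = 1"
    and Q: "cmod (Q - \<omega> * P) \<le> (13/500)" and t: "cmod (\<tau> - \<omega> * \<sigma>) \<le> (13/500)"
    and small: "cmod P \<le> 1" "cmod \<sigma> \<le> 1" "cmod (\<tau> - P) \<le> 1"
    and Q1: "1 - (cmod Q)\<^sup>2 \<le> (21/500)" and t1: "(cmod \<sigma>)\<^sup>2 - (cmod \<tau>)\<^sup>2 \<le> (21/500)"
  shows "(cmod (\<sigma> - P))\<^sup>2 + (cmod \<sigma>)\<^sup>2 - (cmod (\<sigma> - Q))\<^sup>2 \<le> (19/100)"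
proof -
  have inner_mult: "(\<omega> * x) \<bullet> y = x \<bullet> (cnj \<omega> * y)" for x y
    by (simp add: inner_complex_def algebra_simps)
  have cw: "cnj \<omega> * P = P - \<omega> * P" using w by (simp add: algebra_simps) (metis distrib_left mult.right_neutral)
  have e1: "(\<tau> - \<omega> * \<sigma>) \<bullet> P \<le> (13/500)"
  proof -
    have "(\<tau> - \<omega> * \<sigma>) \<bullet> P \<le> cmod (\<tau> - \<omega> * \<sigma>) * cmod P" by (rule norm_cauchy_schwarz)
    also have "\<dots> \<le> (13/500) * 1" using t small by (intro mult_mono) auto
    finally show ?thesis by simp
  qed
  have e2: "\<sigma> \<bullet> (Q - \<omega> * P) \<le> (13/500)"
  proof -
    have "\<sigma> \<bullet> (Q - \<omega> * P) \<le> cmod \<sigma> * cmod (Q - \<omega> * P)" by (rule norm_cauchy_schwarz)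
    also have "\<dots> \<le> 1 * (13/500)" using Q small by (intro mult_mono) auto
    finally show ?thesis by simp
  qed
  have "(cmod (\<tau> - P))\<^sup>2 \<le> 1" using small(3) by (simp add: power_le_one)
  then have 1: "(cmod \<tau>)\<^sup>2 - 2 * (\<tau> \<bullet> P) + (cmod P)\<^sup>2 \<le> 1"
    by (simp add: power2_norm_eq_inner inner_diff inner_commute algebra_simps)
  have "\<tau> \<bullet> P = (\<tau> - \<omega> * \<sigma>) \<bullet> P + \<sigma> \<bullet> (P - \<omega> * P)"
    by (simp add: inner_diff_left inner_mult cw)
  also have "\<sigma> \<bullet> (P - \<omega> * P) = \<sigma> \<bullet> (P - Q) + \<sigma> \<bullet> (Q - \<omega> * P)"
    by (simp add: inner_diff_right)
  finally have 2: "\<tau> \<bullet> P \<le> (13/250) + \<sigma> \<bullet> (P - Q)" using e1 e2 by simp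
  have "(cmod (\<sigma> - P))\<^sup>2 - (cmod (\<sigma> - Q))\<^sup>2 = (cmod P)\<^sup>2 - (cmod Q)\<^sup>2 - 2 * (\<sigma> \<bullet> (P - Q))"
    by (simp add: power2_norm_eq_inner inner_diff inner_commute algebra_simps)
  with 1 2 Q1 t1 show ?thesis by linarith
qed

text \<open>The third vertex \<open>t\<close> on the pair \<open>v, s\<close> arises from \<open>s\<close> by a rotation about \<open>v\<close> through 60 degrees
in one of the two senses. That rotation takes \<open>p\<close> near \<open>q\<close> or \<open>q\<close> near \<open>p\<close>; the two cases give the
two alternatives.\<close>

lemma third_point:
  assumes pq: "near_equilateral v p q" and st: "near_equilateral v s t"
    and diam: "dist v p \<le> 1" "dist v q \<le> 1" "dist v s \<le> 1" "dist t p \<le> 1" "dist t q \<le> 1" "dist s t \<le> 1"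
    and long: "1 - (dist v p)\<^sup>2 \<le> (21/500)" "1 - (dist v q)\<^sup>2 \<le> (21/500)"
  shows "(dist s p)\<^sup>2 + (dist s v)\<^sup>2 - (dist s q)\<^sup>2 \<le> (19/100) \<or>
         (dist s q)\<^sup>2 + (dist s v)\<^sup>2 - (dist s p)\<^sup>2 \<le> (19/100)"
proof -
  have d: "dist v a = cmod (a - v)" for a
    by (simp add: dist_norm norm_minus_commute)
  from near_equilateral_rot60[OF pq] obtain w where
    w: "w \<in> {rot60, cnj rot60}" "cmod ((q - v) - w * (p - v)) \<le> (13/500) * cmod (p - v)" by blast
  from near_equilateral_rot60[OF st] obtain u where
    u: "u \<in> {rot60, cnj rot60}" "cmod ((t - v) - u * (s - v)) \<le> (13/500) * cmod (s - v)" by blast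
  have w2: "cmod ((q - v) - w * (p - v)) \<le> (13/500)" using w(2) diam(1) unfolding d by linarith
  have u2: "cmod ((t - v) - u * (s - v)) \<le> (13/500)" using u(2) diam(3) unfolding d by linarith
  have r: "cmod rot60 = 1" "rot60 * cnj rot60 = 1" "rot60 + cnj rot60 = 1"
    by (simp_all add: rot60_def cmod_def complex_eq_iff power2_eq_square)
  have r': "cmod w = 1" "w * cnj w = 1" "w + cnj w = 1" "cmod u = 1" "u * cnj u = 1" "u + cnj u = 1"
    using w(1) u(1) r by (auto simp: mult.commute add.commute)
  have t1: "(cmod (s - v))\<^sup>2 - (cmod (t - v))\<^sup>2 \<le> (21/500)"
  proof -
    have "(dist v s)\<^sup>2 - (dist v t)\<^sup>2 \<le> 21/500 * (dist s t)\<^sup>2"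
      using st unfolding near_equilateral_def by linarith
    moreover have "(dist s t)\<^sup>2 \<le> 1" using diam(6) by (simp add: power_le_one)
    ultimately show ?thesis by (simp add: dist_norm norm_minus_commute)
  qed
  show ?thesis
  proof (cases "u = w")
    case True
    have "(cmod ((s - v) - (p - v)))\<^sup>2 + (cmod (s - v))\<^sup>2 - (cmod ((s - v) - (q - v)))\<^sup>2 \<le> (19/100)"
      by (rule third_point_core[of w "q - v" "p - v" "t - v" "s - v"])
        (use r' w2 u2 t1 True diam long in \<open>simp_all add: dist_norm norm_minus_commute\<close>)
    then show ?thesis by (simp add: dist_norm norm_minus_commute)
  next
    case False
    then have u: "u = cnj w" using w(1) u(1) by auto
    have "cmod ((q - v) - w * (p - v)) = cmod (u * ((q - v) - w * (p - v)))"
      using r' by (simp add: norm_mult)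
    also have "u * ((q - v) - w * (p - v)) = u * (q - v) - (w * cnj w) * (p - v)"
      using u by (simp add: algebra_simps)
    finally have w3: "cmod ((p - v) - u * (q - v)) \<le> (13/500)"
      using w2 r' by (simp add: norm_minus_commute)
    have "(cmod ((s - v) - (q - v)))\<^sup>2 + (cmod (s - v))\<^sup>2 - (cmod ((s - v) - (p - v)))\<^sup>2 \<le> (19/100)"
      by (rule third_point_core[of u "p - v" "q - v" "t - v" "s - v"])
        (use r' w3 u2 t1 diam long in \<open>simp_all add: dist_norm norm_minus_commute\<close>)
    then show ?thesis by (simp add: dist_norm norm_minus_commute)
  qed
qed


text \<open>With \<open>x\<close> the cross product of \<open>d\<close> and \<open>e\<close>, the vector \<open>(d \<bullet> g) e - (e \<bullet> g) d\<close> is \<open>x\<close> times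
\<open>g\<close> turned through a right angle; both sides are 4 times its squared length. It holds only in the
plane.\<close>

lemma cross_product_identity:
  fixes d e g :: complex
  shows "4 * (cmod g)\<^sup>2 * ((cmod d)\<^sup>2 * (cmod e)\<^sup>2 - (d \<bullet> e)\<^sup>2)
    = 4 * ((d \<bullet> g)\<^sup>2 * (cmod e)\<^sup>2 + (e \<bullet> g)\<^sup>2 * (cmod d)\<^sup>2 - 2 * (d \<bullet> g) * (e \<bullet> g) * (d \<bullet> e))"
  unfolding cmod_power2 inner_complex_def by algebra

text \<open>A near-equilateral triangle that is narrow in the direction \<open>g\<close> is small, since the width of an
equilateral triangle in any direction is at least its height.\<close>

lemma side_le_of_width:
  fixes d e g :: complex
  assumes g: "(cmod g)\<^sup>2 \<ge> 239/250"
    and \<alpha>: "\<bar>d \<bullet> g\<bar> \<le> 29/250" and \<beta>: "\<bar>e \<bullet> g\<bar> \<le> 29/250" and \<alpha>\<beta>: "\<bar>d \<bullet> g - e \<bullet> g\<bar> \<le> 19/100"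
    and ne: "near_equilateral 0 d e"
  shows "(cmod d)\<^sup>2 \<le> 13/250"
proof -
  define \<rho> a b where "\<rho> = (cmod d)\<^sup>2" "a = (cmod e)\<^sup>2" "b = (cmod (d - e))\<^sup>2"
  define x y where "x = d \<bullet> g" "y = e \<bullet> g"
  have nonneg: "\<rho> \<ge> 0" "a \<ge> 0" "b \<ge> 0" by (simp_all add: \<rho>_a_b_def)
  have n: "\<bar>\<rho> - a\<bar> \<le> 21/500 * b" "\<bar>\<rho> - b\<bar> \<le> 21/500 * a" "\<bar>a - b\<bar> \<le> 21/500 * \<rho>"
    using ne by (simp_all add: near_equilateral_def \<rho>_a_b_def dist_norm)
  with nonneg have a: "239/250 * \<rho> \<le> a" "a \<le> 261/250 * \<rho>" and b: "239/250 * \<rho> \<le> b" "b \<le> 261/250 * \<rho>"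
    by linarith+
  have i: "d \<bullet> e = (\<rho> + a - b) / 2"
    unfolding \<rho>_a_b_def cmod_power2 inner_complex_def by (simp add: power2_eq_square algebra_simps)
  have c: "479/500 * \<rho> \<le> \<rho> + a - b" "\<rho> + a - b \<le> 521/500 * \<rho>"
    using n(3)[unfolded abs_le_iff] by simp_all
  have "x\<^sup>2 \<le> (29/250)\<^sup>2" "y\<^sup>2 \<le> (29/250)\<^sup>2" "(x - y)\<^sup>2 \<le> (19/100)\<^sup>2"
    using \<alpha> \<beta> \<alpha>\<beta> by (simp_all only: x_y_def abs_le_square_iff[symmetric] abs_numeral abs_divide)
  then have sq: "x\<^sup>2 \<le> 841/62500" "y\<^sup>2 \<le> 841/62500" "x\<^sup>2 + y\<^sup>2 - 2 * (x * y) \<le> 361/10000"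
    by (simp_all add: power2_eq_square algebra_simps)
  have xy: "\<bar>x * y\<bar> \<le> 841/62500"
  proof -
    have "\<bar>x\<bar> * \<bar>y\<bar> \<le> 29/250 * (29/250)" using \<alpha> \<beta> by (intro mult_mono) (auto simp: x_y_def)
    then show ?thesis by (simp add: abs_mult)
  qed
  have "x\<^sup>2 * a \<le> x\<^sup>2 * (261/250 * \<rho>)" using a by (intro mult_left_mono) auto
  moreover have "- (x * y * (\<rho> + a - b)) \<le> - (x * y * \<rho>) + 21/500 * (841/62500) * \<rho>"
  proof -
    have "- (x * y) * (a - b) \<le> \<bar>x * y\<bar> * \<bar>a - b\<bar>" by (simp add: abs_mult[symmetric] del: abs_mult)
    also have "\<dots> \<le> 841/62500 * (21/500 * \<rho>)" using xy n(3) by (intro mult_mono) auto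
    finally show ?thesis by (simp add: algebra_simps)
  qed
  ultimately have "x\<^sup>2 * a + y\<^sup>2 * \<rho> - x * y * (\<rho> + a - b)
      \<le> (261/250 * x\<^sup>2 + y\<^sup>2 - x * y + 21/500 * (841/62500)) * \<rho>"
    by (simp add: algebra_simps)
  also have "\<dots> \<le> 33/1000 * \<rho>"
    using sq nonneg by (intro mult_right_mono) linarith+
  finally have up: "x\<^sup>2 * a + y\<^sup>2 * \<rho> - x * y * (\<rho> + a - b) \<le> 33/1000 * \<rho>" .
  have "4 * (\<rho> * a) - (\<rho> + a - b)\<^sup>2 \<ge> 4 * (239/250 * \<rho>\<^sup>2) - (521/500 * \<rho>)\<^sup>2"
  proof -
    have "\<rho> * (239/250 * \<rho>) \<le> \<rho> * a" using a nonneg by (intro mult_left_mono)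
    moreover have "(\<rho> + a - b)\<^sup>2 \<le> (521/500 * \<rho>)\<^sup>2" using c nonneg by (intro power_mono) linarith+
    ultimately show ?thesis by (simp add: power2_eq_square)
  qed
  moreover have "(521/500 * \<rho>)\<^sup>2 = 271441/250000 * \<rho>\<^sup>2" by (simp add: power2_eq_square)
  ultimately have low: "4 * (\<rho> * a) - (\<rho> + a - b)\<^sup>2 \<ge> 273/100 * \<rho>\<^sup>2"
    using zero_le_power2[of \<rho>] by linarith
  have "239/250 * (273/100 * \<rho>\<^sup>2) \<le> (cmod g)\<^sup>2 * (4 * (\<rho> * a) - (\<rho> + a - b)\<^sup>2)"
    using g low by (intro mult_mono) auto
  also have "\<dots> = 4 * (x\<^sup>2 * a + y\<^sup>2 * \<rho> - x * y * (\<rho> + a - b))"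
  proof -
    define w where "w = \<rho> + a - b"
    have "4 * (cmod g)\<^sup>2 * (\<rho> * a - (w / 2)\<^sup>2)
        = 4 * (x\<^sup>2 * a + y\<^sup>2 * \<rho> - 2 * x * y * (w / 2))"
      using cross_product_identity[of g d e] unfolding i w_def \<rho>_a_b_def(1,2) x_y_def .
    moreover have "4 * (w / 2)\<^sup>2 = w\<^sup>2" by (simp add: power2_eq_square)
    ultimately show ?thesis unfolding w_def[symmetric] by (simp add: algebra_simps)
  qed
  also have "\<dots> \<le> 4 * (33/1000 * \<rho>)" using up by simp
  finally have "\<rho> * \<rho> \<le> 13/250 * \<rho>" using nonneg by (simp add: power2_eq_square)
  then show ?thesis
    using nonneg(1) unfolding \<rho>_a_b_def(1)[symmetric] by (metis less_eq_real_def mult_le_cancel_right_pos divide_nonneg_nonneg zero_le_numeral zero_le_one order_trans)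
qed

lemma sq_le_iff_dist: "(dist x y)\<^sup>2 \<le> c \<Longrightarrow> 0 \<le> k \<Longrightarrow> c \<le> k\<^sup>2 \<Longrightarrow> dist x y \<le> k"
  by (meson order_trans power2_le_imp_le)

text \<open>Write \<open>X, Y, Z\<close> for the squared distances from \<open>s\<close> to \<open>p, q, v\<close>, with \<open>X\<close> the smallest. The third
points on \<open>s, v\<close> and on \<open>s, q\<close> give \<open>X + Z \<le> Y\<close> and \<open>X + Y \<le> Z\<close> up to an error, for the other
alternatives would put \<open>s\<close> close to both \<open>q\<close> and \<open>v\<close>. So \<open>X\<close> and \<open>|Y - Z|\<close> are at most the error.\<close>

lemma nearest_vertex_estimate:
  assumes pqv: "near_equilateral v p q" and sv: "near_equilateral v s t" and sq: "near_equilateral q s t'"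
    and diam: "\<And>x y. x \<in> {v, p, q, s, t, t'} \<Longrightarrow> y \<in> {v, p, q, s, t, t'} \<Longrightarrow> dist x y \<le> 1"
    and long: "(dist v p)\<^sup>2 \<ge> 479/500" "(dist v q)\<^sup>2 \<ge> 479/500" "(dist p q)\<^sup>2 \<ge> 479/500"
    and near: "dist s p \<le> dist s q" "dist s p \<le> dist s v"
  shows "(dist s p)\<^sup>2 \<le> 19/100 \<and> \<bar>(dist s q)\<^sup>2 - (dist s v)\<^sup>2\<bar> \<le> 19/100"
proof -
  have near2: "(dist s p)\<^sup>2 \<le> (dist s q)\<^sup>2" "(dist s p)\<^sup>2 \<le> (dist s v)\<^sup>2"
    using near by (intro power_mono; simp)+
  have far: False if "(dist s q)\<^sup>2 \<le> 19/100" "(dist s v)\<^sup>2 \<le> 19/100"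
  proof -
    have "dist s q \<le> 11/25" "dist s v \<le> 11/25"
      by (rule sq_le_iff_dist[OF that(1)]; simp add: power2_eq_square)
        (rule sq_le_iff_dist[OF that(2)]; simp add: power2_eq_square)
    then have "dist v q \<le> 22/25" using dist_triangle[of v q s] by (simp add: dist_commute)
    then have "(dist v q)\<^sup>2 \<le> (22/25)\<^sup>2" by (intro power_mono) auto
    with long show False by (simp add: power2_eq_square)
  qed
  have 1: "(dist s p)\<^sup>2 + (dist s v)\<^sup>2 - (dist s q)\<^sup>2 \<le> 19/100 \<or>
         (dist s q)\<^sup>2 + (dist s v)\<^sup>2 - (dist s p)\<^sup>2 \<le> 19/100"
    by (rule third_point[OF pqv sv]) (use diam long in auto)
  have qpv: "near_equilateral q p v"
    using pqv near_equilateral_rotate near_equilateral_swap by metis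
  have 2: "(dist s p)\<^sup>2 + (dist s q)\<^sup>2 - (dist s v)\<^sup>2 \<le> 19/100 \<or>
         (dist s v)\<^sup>2 + (dist s q)\<^sup>2 - (dist s p)\<^sup>2 \<le> 19/100"
    by (rule third_point[OF qpv sq]) (use diam long in \<open>auto simp: dist_commute\<close>)
  have nn: "(dist s p)\<^sup>2 \<ge> 0" by simp
  from far near2 1 2 nn show ?thesis by linarith
qed


text \<open>The previous estimate leaves \<open>s\<close> within about \<open>0.44\<close> of \<open>p\<close>, too far for separated clusters, but
it also confines \<open>s\<close> to a thin strip around the bisector at \<open>p\<close>. The third point \<open>r\<close> on \<open>s, p\<close> is
nearest to \<open>p\<close> as well and lies in the same strip, so the whole triangle \<open>s p r\<close> does, which forces it
to be small.\<close>

lemma vertex_cluster_small: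
  assumes S: "\<And>x y. x \<in> S \<Longrightarrow> y \<in> S \<Longrightarrow> dist x y \<le> 1"
    and cov: "\<And>x y. x \<in> S \<Longrightarrow> y \<in> S \<Longrightarrow> x \<noteq> y \<Longrightarrow> \<exists>z\<in>S. near_equilateral x y z"
    and vpq: "near_equilateral v p q" and mem: "v \<in> S" "p \<in> S" "q \<in> S"
    and long: "(dist v p)\<^sup>2 \<ge> 479/500" "(dist v q)\<^sup>2 \<ge> 479/500" "(dist p q)\<^sup>2 \<ge> 479/500"
    and s: "s \<in> S" "dist s p \<le> dist s q" "dist s p \<le> dist s v"
  shows "(dist s p)\<^sup>2 \<le> 13/250"
proof (cases "s = p")
  case False
  have est: "(dist u b)\<^sup>2 \<le> 19/100 \<and> \<bar>(dist u c)\<^sup>2 - (dist u a)\<^sup>2\<bar> \<le> 19/100"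
    if abc: "near_equilateral a b c" "a \<in> S" "b \<in> S" "c \<in> S"
      and l: "(dist a b)\<^sup>2 \<ge> 479/500" "(dist a c)\<^sup>2 \<ge> 479/500" "(dist b c)\<^sup>2 \<ge> 479/500"
      and u: "u \<in> S" "dist u b \<le> dist u c" "dist u b \<le> dist u a" for a b c u
  proof -
    have "b \<noteq> a" "b \<noteq> c" using l by auto
    then have "u \<noteq> a" "u \<noteq> c" using u by auto
    then obtain t t' where "t \<in> S" "near_equilateral a u t" "t' \<in> S" "near_equilateral c u t'"
      using cov abc u(1) by metis
    with S abc u l show ?thesis by (intro nearest_vertex_estimate[of a b c u t t']) auto
  qed
  obtain r where r: "r \<in> S" "near_equilateral s p r" using cov s(1) mem(2) False by blast
  have sp: "(dist s p)\<^sup>2 \<le> 19/100" "\<bar>(dist s q)\<^sup>2 - (dist s v)\<^sup>2\<bar> \<le> 19/100"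
    using est[OF vpq mem long s] by auto
  have rp: "(dist r p)\<^sup>2 \<le> 261/250 * (dist s p)\<^sup>2"
    using near_equilateral_ratio(1)[OF near_equilateral_rotate[OF r(2)]] by (simp add: dist_commute)
  have rp': "dist r p \<le> 9/20"
    by (rule power2_le_imp_le) (use rp sp(1) in \<open>simp_all add: power2_eq_square\<close>)
  have not_near: False if "(dist r u)\<^sup>2 \<le> 19/100" "(dist p u)\<^sup>2 \<ge> 479/500" for u
  proof -
    have "dist r u \<le> 11/25" by (rule sq_le_iff_dist[OF that(1)]) (simp_all add: power2_eq_square)
    then have "dist p u \<le> 89/100" using rp' dist_triangle[of p u r] by (simp add: dist_commute)
    then have "(dist p u)\<^sup>2 \<le> (89/100)\<^sup>2" by (intro power_mono) auto
    with that(2) show False by (simp add: power2_eq_square)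
  qed
  have "dist r p \<le> dist r q \<and> dist r p \<le> dist r v"
  proof (rule ccontr)
    assume "\<not> ?thesis"
    then consider "dist r q \<le> dist r p" "dist r q \<le> dist r v" | "dist r v \<le> dist r p" "dist r v \<le> dist r q"
      by linarith
    then show False
    proof cases
      case 1
      have "(dist r q)\<^sup>2 \<le> 19/100"
        using est[of p q v r] near_equilateral_rotate[OF vpq] mem long r(1) 1
        by (simp add: dist_commute)
      with not_near long(3) show False by blast
    next
      case 2
      have "(dist r v)\<^sup>2 \<le> 19/100"
        using est[of q v p r] near_equilateral_rotate[OF near_equilateral_rotate[OF vpq]] mem long r(1) 2
        by (simp add: dist_commute)
      moreover have "(dist p v)\<^sup>2 \<ge> 479/500" using long(1) by (simp add: dist_commute)
      ultimately show False by (rule not_near)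
    qed
  qed
  then have rq: "\<bar>(dist r q)\<^sup>2 - (dist r v)\<^sup>2\<bar> \<le> 19/100"
    using est[OF vpq mem long r(1)] by auto
  have pv: "\<bar>(dist p q)\<^sup>2 - (dist p v)\<^sup>2\<bar> \<le> 21/500"
  proof -
    have "\<bar>(dist v p)\<^sup>2 - (dist p q)\<^sup>2\<bar> \<le> 21/500 * (dist v q)\<^sup>2"
      using vpq by (simp add: near_equilateral_def)
    moreover have "(dist v q)\<^sup>2 \<le> 1" using S mem by (simp add: power_le_one)
    ultimately have "\<bar>(dist v p)\<^sup>2 - (dist p q)\<^sup>2\<bar> \<le> 21/500" by linarith
    then show ?thesis by (simp add: dist_commute abs_minus_commute)
  qed
  \<comment> \<open>The difference of the squared distances to \<open>q\<close> and \<open>v\<close> measures the position across the strip.\<close>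
  have ip: "2 * ((u - p) \<bullet> (v - q)) = ((dist u q)\<^sup>2 - (dist u v)\<^sup>2) - ((dist p q)\<^sup>2 - (dist p v)\<^sup>2)" for u
    unfolding sq_dist inner_complex_def by (simp add: power2_eq_square algebra_simps)
  have "(cmod (s - p))\<^sup>2 \<le> 13/250"
  proof (rule side_le_of_width[where e = "r - p" and g = "v - q"])
    show "(cmod (v - q))\<^sup>2 \<ge> 239/250" using long(2) by (simp add: dist_norm)
    show "\<bar>(s - p) \<bullet> (v - q)\<bar> \<le> 29/250" using ip[of s] sp(2) pv by linarith
    show "\<bar>(r - p) \<bullet> (v - q)\<bar> \<le> 29/250" using ip[of r] rq pv by linarith
    show "\<bar>(s - p) \<bullet> (v - q) - (r - p) \<bullet> (v - q)\<bar> \<le> 19/100"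
      using ip[of s] ip[of r] sp(2) rq by linarith
    show "near_equilateral 0 (s - p) (r - p)"
      using near_equilateral_swap[OF r(2)] by (simp add: near_equilateral_def dist_norm norm_minus_commute)
  qed
  then show ?thesis by (simp add: dist_norm)
qed simp

text \<open>Let \<open>a, b\<close> realise the diameter and \<open>e\<close> be a third point on them. Colour each point by the nearest
vertex of \<open>a b e\<close>. The points of a colour lie within \<open>0.23\<close> of their vertex, hence within \<open>0.46\<close> of each
other, whereas points of different colours are more than \<open>0.51\<close> apart. No near-equilateral triangle
has two sides in this proportion, so none has exactly two vertices of one colour.\<close>

theorem covered_set_splits:
  assumes S: "\<And>x y. x \<in> S \<Longrightarrow> y \<in> S \<Longrightarrow> dist x y \<le> 1"
    and cov: "\<And>x y. x \<in> S \<Longrightarrow> y \<in> S \<Longrightarrow> x \<noteq> y \<Longrightarrow> \<exists>z\<in>S. near_equilateral x y z"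
    and ab: "a \<in> S" "b \<in> S" "dist a b = 1"
  obtains c :: "complex \<Rightarrow> nat" where "\<And>x. c x < 3" "c a \<noteq> c b"
    "\<And>x y z. x \<in> S \<Longrightarrow> y \<in> S \<Longrightarrow> z \<in> S \<Longrightarrow> near_equilateral x y z \<Longrightarrow>
       (c x = c y \<and> c y = c z) \<or> (c x \<noteq> c y \<and> c y \<noteq> c z \<and> c x \<noteq> c z)"
proof -
  have "a \<noteq> b" using ab by auto
  then obtain e where e: "e \<in> S" "near_equilateral a b e" using cov ab by blast
  have "(dist a e)\<^sup>2 \<le> 1" "(dist b e)\<^sup>2 \<le> 1" using S ab e by (simp_all add: power_le_one)
  with e(2) ab(3) have ae: "(dist a e)\<^sup>2 \<ge> 479/500" and be: "(dist b e)\<^sup>2 \<ge> 479/500"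
    unfolding near_equilateral_def abs_le_iff by auto
  define V where "V i = (if i = (0::nat) then a else if i = 1 then b else e)" for i
  define c :: "complex \<Rightarrow> nat" where
    "c s = (if dist s a \<le> dist s b \<and> dist s a \<le> dist s e then 0 else if dist s b \<le> dist s e then 1 else 2)" for s
  have c3: "c s < 3" for s by (simp add: c_def)
  have near: "dist s (V (c s)) \<le> 23/100" if "s \<in> S" for s
  proof -
    have vc: "(dist s p)\<^sup>2 \<le> 13/250"
      if "near_equilateral v p q" "v \<in> S" "p \<in> S" "q \<in> S" "(dist v p)\<^sup>2 \<ge> 479/500"
        "(dist v q)\<^sup>2 \<ge> 479/500" "(dist p q)\<^sup>2 \<ge> 479/500" "dist s p \<le> dist s q" "dist s p \<le> dist s v" for v p q
      by (rule vertex_cluster_small[where S = S, OF _ _ that(1-7) \<open>s \<in> S\<close> that(8,9)]) (fact S, fact cov)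
    have "(dist s (V (c s)))\<^sup>2 \<le> 13/250"
    proof -
      have p: "near_equilateral b a e" "near_equilateral a b e" "near_equilateral a e b"
        using e(2) near_equilateral_swap near_equilateral_rotate by metis+
      have "(c s = 0 \<and> dist s a \<le> dist s b \<and> dist s a \<le> dist s e)
          \<or> (c s = 1 \<and> dist s b \<le> dist s a \<and> dist s b \<le> dist s e)
          \<or> (c s = 2 \<and> dist s e \<le> dist s a \<and> dist s e \<le> dist s b)"
        unfolding c_def by (simp split: if_split) linarith
      then consider "c s = 0" "dist s a \<le> dist s b" "dist s a \<le> dist s e"
        | "c s = 1" "dist s b \<le> dist s a" "dist s b \<le> dist s e"
        | "c s = 2" "dist s e \<le> dist s a" "dist s e \<le> dist s b"
        by metis
      then show ?thesis
      proof cases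
        case 1
        then show ?thesis using vc[OF p(1)] ab e(1) ae be by (simp add: V_def dist_commute)
      next
        case 2
        then show ?thesis using vc[OF p(2)] ab e(1) ae be by (simp add: V_def dist_commute)
      next
        case 3
        then show ?thesis using vc[OF p(3)] ab e(1) ae be by (simp add: V_def dist_commute)
      qed
    qed
    then show ?thesis by (rule sq_le_iff_dist) (simp_all add: power2_eq_square)
  qed
  have far: "dist (V i) (V j) \<ge> 489/500" if "i \<noteq> j" "i < 3" "j < 3" for i j
  proof -
    have "i = 0 \<or> i = 1 \<or> i = 2" "j = 0 \<or> j = 1 \<or> j = 2" using that by linarith+
    then have "(dist (V i) (V j))\<^sup>2 \<ge> 479/500"
      using that(1) ae be ab(3) by (auto simp: V_def dist_commute)
    then have "(489/500)\<^sup>2 \<le> (dist (V i) (V j))\<^sup>2" by (simp add: power2_eq_square)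
    then show ?thesis by (rule power2_le_imp_le) simp
  qed
  have no_mix: "c x \<noteq> c y \<or> c x = c z"
    if "x \<in> S" "y \<in> S" "z \<in> S" "near_equilateral x y z" for x y z
  proof (rule ccontr)
    assume "\<not> ?thesis"
    then have eq: "c x = c y" and neq: "c x \<noteq> c z" by auto
    have "dist x y \<le> 23/50"
      using near[OF that(1)] near[OF that(2)] eq dist_triangle[of x y "V (c x)"] by (simp add: dist_commute)
    then have xy: "(dist x y)\<^sup>2 \<le> (23/50)\<^sup>2" by (intro power_mono) auto
    have "489/500 \<le> dist (V (c x)) (V (c z))" using far[OF neq] c3 by simp
    also have "\<dots> \<le> dist x (V (c x)) + dist x z + dist z (V (c z))"
      using dist_triangle[of "V (c x)" "V (c z)" x] dist_triangle[of x "V (c z)" z]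
      by (simp add: dist_commute)
    finally have "dist x z \<ge> 259/500" using near[OF that(1)] near[OF that(3)] by simp
    then have "(259/500)\<^sup>2 \<le> (dist x z)\<^sup>2" by (intro power_mono) auto
    moreover have "(dist x z)\<^sup>2 \<le> 261/250 * (dist x y)\<^sup>2"
      using near_equilateral_ratio(2)[OF that(4)] near_equilateral_ratio(1)[of x z y]
        near_equilateral_swap near_equilateral_rotate that(4) by metis
    ultimately show False using xy by (simp add: power2_eq_square)
  qed
  show thesis
  proof (rule that[of c])
    show "c a \<noteq> c b" using \<open>a \<noteq> b\<close> by (auto simp: c_def ab dist_commute intro: le_less_trans)
  next
    fix x y z assume xyz: "x \<in> S" "y \<in> S" "z \<in> S" "near_equilateral x y z"
    then have "near_equilateral y z x" "near_equilateral z x y"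
      using near_equilateral_rotate by blast+
    with no_mix[of x y z] no_mix[of y z x] no_mix[of z x y] xyz
    show "(c x = c y \<and> c y = c z) \<or> (c x \<noteq> c y \<and> c y \<noteq> c z \<and> c x \<noteq> c z)" by metis
  qed (rule c3)
qed

section \<open>From angles to side lengths\<close>

lemma abs_angle_quotient_le_1:
  fixes a b c :: "'a::real_inner"
  shows "\<bar>((a - b) \<bullet> (c - b)) / (norm (a - b) * norm (c - b))\<bar> \<le> 1"
  using Cauchy_Schwarz_ineq2[of "a - b" "c - b"]
  by (cases "a = b \<or> c = b") (auto simp: abs_mult divide_le_eq_1)

lemma cos_angle_at: "cos (angle_at a b c) = ((a - b) \<bullet> (c - b)) / (norm (a - b) * norm (c - b))"
  unfolding angle_at_def by (rule cos_arccos_abs[OF abs_angle_quotient_le_1])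

lemma law_of_cosines:
  assumes "a \<noteq> b" "c \<noteq> b"
  shows "2 * dist b a * dist b c * cos (angle_at a b c) = (dist b a)\<^sup>2 + (dist b c)\<^sup>2 - (dist a c)\<^sup>2"
proof -
  have "2 * dist b a * dist b c * cos (angle_at a b c) = 2 * ((a - b) \<bullet> (c - b))"
    using assms by (simp add: cos_angle_at dist_norm norm_minus_commute)
  also have "\<dots> = (norm (a - b))\<^sup>2 + (norm (c - b))\<^sup>2 - (norm ((a - b) - (c - b)))\<^sup>2"
    unfolding power2_norm_eq_inner by (simp add: inner_diff inner_commute)
  finally show ?thesis by (simp add: dist_norm norm_minus_commute)
qed

lemma equilateral_distinct: "equilateral A B C \<Longrightarrow> A \<noteq> B \<and> B \<noteq> C \<and> C \<noteq> A"
  by (auto simp: equilateral_def)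

lemma equilateral_rotate: "equilateral A B C \<Longrightarrow> equilateral B C A"
  by (auto simp: equilateral_def)

lemma angle_at_equilateral:
  assumes "equilateral A B C"
  shows "angle_at A B C = pi / 3"
proof -
  have ne: "A \<noteq> B" "C \<noteq> B" using equilateral_distinct[OF assms] by auto
  have d: "dist B C = dist B A" "dist A C = dist B A" using assms by (auto simp: equilateral_def dist_commute)
  have "dist B A > 0" using ne by auto
  with law_of_cosines[OF ne] have "cos (angle_at A B C) = 1 / 2"
    unfolding d by (simp add: power2_eq_square)
  then have "((A - B) \<bullet> (C - B)) / (norm (A - B) * norm (C - B)) = cos (pi / 3)"
    unfolding cos_angle_at cos_60 .
  then show ?thesis by (simp add: angle_at_def arccos_cos)
qed

text \<open>The derivative of the cosine at 60 degrees is \<open>- sqrt 3 / 2\<close>; the Lipschitz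
constant 1 would only give about \<open>0.0175\<close> in place of \<open>19/1250 = 0.0152\<close>.\<close>

lemma cos_near_60:
  assumes "\<bar>pi / 3 - \<theta>\<bar> < pi / 180"
  shows "\<bar>cos \<theta> - 1/2\<bar> \<le> 19/1250"
proof -
  define d where "d = \<theta> - pi / 3"
  have d: "\<bar>d\<bar> \<le> 8727/500000"
    using assms pi_approx by (simp add: d_def abs_minus_commute)
  have "cos \<theta> = cos (pi / 3 + d)" by (simp add: d_def)
  also have "\<dots> = cos d / 2 - sqrt 3 / 2 * sin d"
    by (simp add: cos_add cos_60 sin_60)
  finally have c: "cos \<theta> - 1/2 = - (1 - cos d) / 2 - sqrt 3 / 2 * sin d" by simp
  have "1 - cos d = 2 * (sin (d / 2))\<^sup>2" using cos_double_sin[of "d / 2"] by simp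
  also have "\<dots> \<le> 2 * (d / 2)\<^sup>2"
    using abs_sin_x_le_abs_x[of "d / 2"] by (intro mult_left_mono abs_le_square_iff[THEN iffD1]) simp_all
  also have "\<dots> = d\<^sup>2 / 2" by (simp add: power2_eq_square)
  also have "\<dots> \<le> (8727/500000)\<^sup>2 / 2" 
    using power_mono[OF d abs_ge_zero, of 2] by simp
  finally have 1: "1 - cos d \<le> 16/100000" by (simp add: power2_eq_square)
  have "sqrt 3 \<le> 17321/10000" by (rule real_le_lsqrt) (simp_all add: power2_eq_square)
  then have "sqrt 3 / 2 * \<bar>sin d\<bar> \<le> 17321/20000 * (8727/500000)"
    using abs_sin_x_le_abs_x[of d] d by (intro mult_mono) auto
  then have "\<bar>sqrt 3 / 2 * sin d\<bar> \<le> 17321/20000 * (8727/500000)" by (simp add: abs_mult)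
  moreover define k where "k = sqrt 3 / 2 * sin d"
  ultimately have k: "\<bar>k\<bar> \<le> 1512/100000" by simp
  have "cos \<theta> - 1/2 = - (1 - cos d) / 2 - k" unfolding c k_def ..
  then have "cos \<theta> - 1/2 = cos d / 2 - 1/2 - k" by (simp add: diff_divide_distrib)
  moreover have "cos d \<le> 1" by simp
  ultimately show ?thesis using 1 k unfolding abs_le_iff by linarith
qed

text \<open>Each side is the sum of the projections of the other two on it. Subtracting
\<open>y = z ca + x cc\<close> from \<open>x = z cb + y cc\<close> gives \<open>(x - y) (1 + cc) = z (cb - ca)\<close>.\<close>

lemma side_difference:
  fixes x y z ca cb cc :: real
  assumes pos: "x > 0" "y > 0" "z > 0"
    and law: "2 * y * z * ca = y\<^sup>2 + z\<^sup>2 - x\<^sup>2" "2 * z * x * cb = z\<^sup>2 + x\<^sup>2 - y\<^sup>2" "2 * x * y * cc = x\<^sup>2 + y\<^sup>2 - z\<^sup>2"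
    and cs: "\<bar>ca - 1/2\<bar> \<le> 19/1250" "\<bar>cb - 1/2\<bar> \<le> 19/1250" "\<bar>cc - 1/2\<bar> \<le> 19/1250"
  shows "\<bar>x - y\<bar> \<le> 41/2000 * z"
proof -
  have "2 * x * x = 2 * x * (z * cb + y * cc)" "2 * y * y = 2 * y * (z * ca + x * cc)"
    using law by (simp_all add: power2_eq_square algebra_simps)
  then have "x = z * cb + y * cc" "y = z * ca + x * cc" using pos by simp_all
  then have e: "(x - y) * (1 + cc) = z * (cb - ca)" by (simp add: algebra_simps)
  have c: "1 + cc \<ge> 1856/1250" using cs(3) by linarith
  have "\<bar>x - y\<bar> * (1856/1250) \<le> \<bar>x - y\<bar> * (1 + cc)" using c by (intro mult_left_mono) auto
  also have "\<dots> = \<bar>(x - y) * (1 + cc)\<bar>" using c by (simp add: abs_mult)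
  also have "\<dots> = z * \<bar>cb - ca\<bar>" unfolding e using pos by (simp add: abs_mult)
  also have "\<dots> \<le> z * (38/1250)"
  proof (rule mult_left_mono)
    show "\<bar>cb - ca\<bar> \<le> 38/1250" using cs by linarith
  qed (use pos in simp)
  finally show ?thesis using pos by simp
qed

lemma square_difference:
  fixes x y z :: real
  assumes pos: "x > 0" "y > 0" "z > 0"
    and d: "\<bar>x - y\<bar> \<le> 41/2000 * z" "\<bar>y - z\<bar> \<le> 41/2000 * x" "\<bar>z - x\<bar> \<le> 41/2000 * y"
  shows "\<bar>x\<^sup>2 - y\<^sup>2\<bar> \<le> 21/500 * z\<^sup>2"
proof -
  have "x + y \<le> 20419/10000 * z" using d by linarith
  then have "\<bar>x - y\<bar> * (x + y) \<le> 41/2000 * z * (20419/10000 * z)"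
    using d pos by (intro mult_mono) auto
  also have "\<dots> \<le> 21/500 * z\<^sup>2" using pos by (simp add: power2_eq_square)
  finally show ?thesis
    using pos by (simp add: power2_eq_square square_diff_square_factored abs_mult mult.commute)
qed

definition to_complex :: "real^2 \<Rightarrow> complex" where
  "to_complex x = Complex (x $ 1) (x $ 2)"

lemma dist_to_complex: "dist (to_complex x) (to_complex y) = dist x y"
  by (simp add: to_complex_def dist_vec_def L2_set_def UNIV_2 dist_norm cmod_def)

lemma eps_similar_imp_near_equilateral:
  assumes T: "equilateral A B C" and \<epsilon>: "\<epsilon> \<le> pi / 180"
    and t: "eps_similar \<epsilon> A B C {x, y, z}" "card {x, y, z} = 3"
  shows "near_equilateral (to_complex x) (to_complex y) (to_complex z)"
proof -
  from t obtain p q r where pqr: "{x, y, z} = {p, q, r}" "p \<noteq> q" "q \<noteq> r" "p \<noteq> r"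
    and ang: "\<bar>pi / 3 - angle_at r p q\<bar> < \<epsilon>" "\<bar>pi / 3 - angle_at p q r\<bar> < \<epsilon>" "\<bar>pi / 3 - angle_at q r p\<bar> < \<epsilon>"
    unfolding eps_similar_def
    using angle_at_equilateral[OF T] angle_at_equilateral[OF equilateral_rotate[OF T]]
      angle_at_equilateral[OF equilateral_rotate[OF equilateral_rotate[OF T]]] by auto
  define X Y Z where "X = dist q r" "Y = dist r p" "Z = dist p q"
  have pos: "X > 0" "Y > 0" "Z > 0" using pqr by (simp_all add: X_Y_Z_def)
  have c: "\<bar>cos (angle_at r p q) - 1/2\<bar> \<le> 19/1250" "\<bar>cos (angle_at p q r) - 1/2\<bar> \<le> 19/1250"
    "\<bar>cos (angle_at q r p) - 1/2\<bar> \<le> 19/1250"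
    using ang \<epsilon> by (intro cos_near_60; linarith)+
  have law: "2 * Y * Z * cos (angle_at r p q) = Y\<^sup>2 + Z\<^sup>2 - X\<^sup>2"
    "2 * Z * X * cos (angle_at p q r) = Z\<^sup>2 + X\<^sup>2 - Y\<^sup>2"
    "2 * X * Y * cos (angle_at q r p) = X\<^sup>2 + Y\<^sup>2 - Z\<^sup>2"
    using law_of_cosines[of r p q] law_of_cosines[of p q r] law_of_cosines[of q r p] pqr
    by (simp_all add: X_Y_Z_def dist_commute)
  have xyz: "\<bar>X - Y\<bar> \<le> 41/2000 * Z" "\<bar>Y - Z\<bar> \<le> 41/2000 * X" "\<bar>Z - X\<bar> \<le> 41/2000 * Y"
    using side_difference[OF pos law c] side_difference[OF pos(2,3,1) law(2,3,1) c(2,3,1)]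
      side_difference[OF pos(3,1,2) law(3,1,2) c(3,1,2)] by auto
  have sq: "\<bar>X\<^sup>2 - Y\<^sup>2\<bar> \<le> 21/500 * Z\<^sup>2" "\<bar>Y\<^sup>2 - Z\<^sup>2\<bar> \<le> 21/500 * X\<^sup>2" "\<bar>Z\<^sup>2 - X\<^sup>2\<bar> \<le> 21/500 * Y\<^sup>2"
    using square_difference[OF pos xyz] square_difference[OF pos(2,3,1) xyz(2,3,1)]
      square_difference[OF pos(3,1,2) xyz(3,1,2)] by auto
  have near: "near_equilateral (to_complex p) (to_complex q) (to_complex r)"
    unfolding near_equilateral_def dist_to_complex
    using sq by (simp add: X_Y_Z_def dist_commute abs_minus_commute)
  have "x \<noteq> y" "y \<noteq> z" "x \<noteq> z" using t(2) by (auto simp: card_insert_if split: if_splits)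
  moreover have "x \<in> {p, q, r}" "y \<in> {p, q, r}" "z \<in> {p, q, r}" using pqr(1) by auto
  ultimately show ?thesis
    using near near_equilateral_rotate near_equilateral_swap by (smt (verit) insert_iff singletonD)
qed

lemma triple_through:
  assumes "card t = 3" "x \<in> t" "y \<in> t" "x \<noteq> y"
  obtains z where "t = {x, y, z}"
proof -
  from assms have "card (t - {x, y}) = 1" by (simp add: card_Diff_subset card_ge_0_finite)
  then obtain z where "t - {x, y} = {z}" by (auto simp: card_1_singleton_iff)
  then have "t = {x, y, z}" using assms by blast
  then show thesis by (rule that)
qed

text \<open>Being near-equilateral is invariant under scaling, so the diameter may be normalised to 1 as
\<open>covered_set_splits\<close> requires.\<close>

lemma covered_set_has_splitting:
  assumes T: "equilateral A B C" and \<epsilon>: "\<epsilon> \<le> pi / 180"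
    and E: "E = {t. card t = 3 \<and> eps_similar \<epsilon> A B C t}"
    and S: "finite S" "2 \<le> card S"
    and cov: "\<And>x y. x \<in> S \<Longrightarrow> y \<in> S \<Longrightarrow> x \<noteq> y \<Longrightarrow> \<exists>t\<in>E. t \<subseteq> S \<and> x \<in> t \<and> y \<in> t"
  shows "\<exists>c. splitting E S c"
proof -
  let ?d = "\<lambda>(x, y). dist x y"
  have "S \<noteq> {}" using S by auto
  then have ne: "?d ` (S \<times> S) \<noteq> {}" "finite (?d ` (S \<times> S))" using S by auto
  define D where "D = Max (?d ` (S \<times> S))"
  have "D \<in> ?d ` (S \<times> S)" unfolding D_def using ne by (rule Max_in[rotated])
  then obtain a b where ab: "a \<in> S" "b \<in> S" "dist a b = D" by auto
  have le: "dist x y \<le> D" if "x \<in> S" "y \<in> S" for x y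
    unfolding D_def using ne that by (intro Max_ge) auto
  obtain x y where "x \<in> S" "y \<in> S" "x \<noteq> y"
    using S by (metis card_le_Suc0_iff_eq not_less_eq_eq numeral_2_eq_2)
  then have "D > 0" using le[of x y] by (metis dist_pos_lt less_le_trans)
  define f where "f u = to_complex u / of_real D" for u
  have df: "dist (f u) (f v) = dist u v / D" for u v
  proof -
    have "f u - f v = (to_complex u - to_complex v) / of_real D" by (simp add: f_def diff_divide_distrib)
    then show ?thesis using \<open>D > 0\<close> by (simp add: dist_norm norm_divide dist_to_complex[unfolded dist_norm])
  qed
  have near: "near_equilateral (f x) (f y) (f z)" if "{x, y, z} \<in> E" for x y z
    using eps_similar_imp_near_equilateral[OF T \<epsilon>, of x y z] that
    by (simp add: f_def E near_equilateral_divide)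
  obtain c :: "complex \<Rightarrow> nat" where c: "\<And>x. c x < 3" "c (f a) \<noteq> c (f b)"
    "\<And>x y z. x \<in> f ` S \<Longrightarrow> y \<in> f ` S \<Longrightarrow> z \<in> f ` S \<Longrightarrow> near_equilateral x y z \<Longrightarrow>
       (c x = c y \<and> c y = c z) \<or> (c x \<noteq> c y \<and> c y \<noteq> c z \<and> c x \<noteq> c z)"
  proof (rule covered_set_splits[of "f ` S" "f a" "f b"])
    show "dist u v \<le> 1" if "u \<in> f ` S" "v \<in> f ` S" for u v
      using that le \<open>D > 0\<close> by (auto simp: df)
    show "\<exists>z\<in>f ` S. near_equilateral u v z" if uv: "u \<in> f ` S" "v \<in> f ` S" "u \<noteq> v" for u v
    proof -
      obtain x y where xy: "x \<in> S" "y \<in> S" "x \<noteq> y" "u = f x" "v = f y" using uv by blast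
      from cov[OF xy(1-3)] obtain t where t: "t \<in> E" "t \<subseteq> S" "x \<in> t" "y \<in> t" by blast
      then have "card t = 3" by (simp add: E)
      from triple_through[OF this t(3,4) xy(3)] obtain z where "t = {x, y, z}" by blast
      with t near[of x y z] have "near_equilateral u v (f z)" "f z \<in> f ` S" unfolding xy by simp_all
      then show ?thesis by blast
    qed
    show "dist (f a) (f b) = 1" using \<open>D > 0\<close> ab by (simp add: df)
    show "f a \<in> f ` S" "f b \<in> f ` S" using ab by simp_all
  qed (rule that)
  have "(\<exists>i. \<forall>x\<in>t. (c \<circ> f) x = i) \<or> inj_on (c \<circ> f) t" if t: "t \<in> E" "t \<subseteq> S" for t
  proof -
    from t(1) have "card t = 3" by (simp add: E)
    then obtain x y z where xyz: "t = {x, y, z}" by (auto simp: card_3_iff)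
    with t have "x \<in> S" "y \<in> S" "z \<in> S" "near_equilateral (f x) (f y) (f z)"
      using near[of x y z] by simp_all
    then have "(c (f x) = c (f y) \<and> c (f y) = c (f z)) \<or> (c (f x) \<noteq> c (f y) \<and> c (f y) \<noteq> c (f z) \<and> c (f x) \<noteq> c (f z))"
      by (intro c(3)[of "f x" "f y" "f z"]) (simp_all only: image_eqI)
    then show ?thesis unfolding xyz by (elim disjE conjE) (simp, auto simp: inj_on_def)
  qed
  then have "splitting E S (c \<circ> f)"
    unfolding splitting_def using c(1,2) ab by (intro conjI ballI bexI[of _ a] bexI[of _ b] impI) simp_all
  then show ?thesis by (rule exI[of _ "c \<circ> f"])
qed

theorem num_similar_le_h_seq:
  assumes "equilateral A B C" "\<epsilon> \<le> pi / 180" "finite P"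
  shows "num_similar \<epsilon> A B C P \<le> h_seq (card P)"
proof -
  define E where "E = {t. card t = 3 \<and> eps_similar \<epsilon> A B C t}"
  have "num_similar \<epsilon> A B C P = card {t \<in> E. t \<subseteq> P}"
    unfolding num_similar_def E_def by (rule arg_cong[of _ _ card]) auto
  also have "\<dots> \<le> h_seq (card P)"
  proof (rule card_edges_le_h_seq[OF _ _ assms(3)])
    show "card t = 3" if "t \<in> E" for t using that by (simp add: E_def)
    show "\<exists>c. splitting E S c"
      if "finite S" "2 \<le> card S" "\<And>x y. x \<in> S \<Longrightarrow> y \<in> S \<Longrightarrow> x \<noteq> y \<Longrightarrow> \<exists>t\<in>E. t \<subseteq> S \<and> x \<in> t \<and> y \<in> t" for S
      by (rule covered_set_has_splitting[OF assms(1,2) E_def that])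
  qed
  finally show ?thesis .
qed

section \<open>The recursive construction\<close>

lemma tendsto_angle_at:
  assumes "(f \<longlongrightarrow> a) F" "(g \<longlongrightarrow> b) F" "(h \<longlongrightarrow> c) F" "a \<noteq> b" "c \<noteq> b"
  shows "((\<lambda>x. angle_at (f x) (g x) (h x)) \<longlongrightarrow> angle_at a b c) F"
proof -
  have bound: "((x - y) \<bullet> (z - y)) / (norm (x - y) * norm (z - y)) \<in> {-1..1}" for x y z :: "real^2"
    using abs_angle_quotient_le_1[of x y z]
    by (metis abs_le_D1 abs_le_D2 atLeastAtMost_iff minus_le_iff)
  have "((\<lambda>x. ((f x - g x) \<bullet> (h x - g x)) / (norm (f x - g x) * norm (h x - g x)))
      \<longlongrightarrow> ((a - b) \<bullet> (c - b)) / (norm (a - b) * norm (c - b))) F"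
    using assms by (intro tendsto_intros) auto
  from continuous_on_tendsto_compose[OF continuous_on_arccos' this] bound show ?thesis
    unfolding angle_at_def by simp
qed

text \<open>The angles depend continuously on the vertices, so clusters around the vertices of \<open>A B C\<close> may be
chosen so small that every transversal triple is \<open>\<epsilon>\<close>-similar to it.\<close>

lemma eps_similar_perturb:
  assumes ne: "A \<noteq> B" "B \<noteq> C" "C \<noteq> A" and "\<epsilon> > 0"
  obtains \<delta> where "\<delta> > 0"
    "\<And>p q r. dist p A < \<delta> \<Longrightarrow> dist q B < \<delta> \<Longrightarrow> dist r C < \<delta> \<Longrightarrow>
       p \<noteq> q \<and> q \<noteq> r \<and> p \<noteq> r \<and> eps_similar \<epsilon> A B C {p, q, r}"
proof -
  let ?F = "nhds (A, B, C)"
  let ?p = "\<lambda>t :: (real^2) \<times> (real^2) \<times> (real^2). fst t"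
  let ?q = "\<lambda>t :: (real^2) \<times> (real^2) \<times> (real^2). fst (snd t)"
  let ?r = "\<lambda>t :: (real^2) \<times> (real^2) \<times> (real^2). snd (snd t)"
  have lim: "(?p \<longlongrightarrow> A) ?F" "(?q \<longlongrightarrow> B) ?F" "(?r \<longlongrightarrow> C) ?F"
    by (auto intro!: tendsto_eq_intros filterlim_ident)
  have close: "\<forall>\<^sub>F t in ?F. \<bar>angle_at x y z - angle_at (f t) (g t) (h t)\<bar> < \<epsilon>"
    if "(f \<longlongrightarrow> x) ?F" "(g \<longlongrightarrow> y) ?F" "(h \<longlongrightarrow> z) ?F" "x \<noteq> y" "z \<noteq> y" for f g h x y z
    using tendstoD[OF tendsto_angle_at[OF that] \<open>\<epsilon> > 0\<close>]
    by (simp add: dist_real_def abs_minus_commute)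
  have distinct: "\<forall>\<^sub>F t in ?F. f t \<noteq> g t"
    if "(f \<longlongrightarrow> x) ?F" "(g \<longlongrightarrow> y) ?F" "x \<noteq> y" for f g :: "_ \<Rightarrow> real^2" and x y
  proof -
    have "((\<lambda>t. f t - g t) \<longlongrightarrow> x - y) ?F" using that by (intro tendsto_diff)
    then have "\<forall>\<^sub>F t in ?F. f t - g t \<noteq> 0" by (rule tendsto_imp_eventually_ne) (use that in simp)
    then show ?thesis by simp
  qed
  have "\<forall>\<^sub>F t in ?F. ?p t \<noteq> ?q t \<and> ?q t \<noteq> ?r t \<and> ?p t \<noteq> ?r t
      \<and> \<bar>angle_at C A B - angle_at (?r t) (?p t) (?q t)\<bar> < \<epsilon>
      \<and> \<bar>angle_at A B C - angle_at (?p t) (?q t) (?r t)\<bar> < \<epsilon>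
      \<and> \<bar>angle_at B C A - angle_at (?q t) (?r t) (?p t)\<bar> < \<epsilon>"
    using distinct[OF lim(1,2) ne(1)] distinct[OF lim(2,3) ne(2)] distinct[OF lim(1,3) ne(3)[symmetric]]
      close[OF lim(3,1,2) ne(3) ne(1)[symmetric]] close[OF lim ne(1) ne(2)[symmetric]]
      close[OF lim(2,3,1) ne(2) ne(3)[symmetric]]
    by (intro eventually_conj)
  then obtain d where d: "d > 0" and D: "\<And>t. dist t (A, B, C) < d \<Longrightarrow>
      ?p t \<noteq> ?q t \<and> ?q t \<noteq> ?r t \<and> ?p t \<noteq> ?r t
      \<and> \<bar>angle_at C A B - angle_at (?r t) (?p t) (?q t)\<bar> < \<epsilon>
      \<and> \<bar>angle_at A B C - angle_at (?p t) (?q t) (?r t)\<bar> < \<epsilon>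
      \<and> \<bar>angle_at B C A - angle_at (?q t) (?r t) (?p t)\<bar> < \<epsilon>"
    unfolding eventually_nhds_metric by blast
  show thesis
  proof (rule that[of "d / 3"])
    fix p q r assume "dist p A < d / 3" "dist q B < d / 3" "dist r C < d / 3"
    moreover have "dist (p, q, r) (A, B, C) \<le> dist p A + (dist q B + dist r C)"
      unfolding dist_Pair_Pair[of p "(q, r)"] dist_Pair_Pair[of q r]
      by (intro order_trans[OF sqrt_sum_squares_le_sum] add_mono order_refl) auto
    ultimately have "dist (p, q, r) (A, B, C) < d" by linarith
    from D[OF this] show "p \<noteq> q \<and> q \<noteq> r \<and> p \<noteq> r \<and> eps_similar \<epsilon> A B C {p, q, r}"
      unfolding eps_similar_def fst_conv snd_conv by blast
  qed (use d in simp)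
qed

lemma angle_at_homothety:
  assumes "l > 0"
  shows "angle_at (Z + l *\<^sub>R a) (Z + l *\<^sub>R b) (Z + l *\<^sub>R c) = angle_at a b c"
proof -
  have "Z + l *\<^sub>R x - (Z + l *\<^sub>R y) = l *\<^sub>R (x - y)" for x y :: "real^2"
    by (simp add: scaleR_diff_right)
  with assms show ?thesis by (simp add: angle_at_def)
qed

lemma num_similar_union:
  assumes fin: "finite P" "finite Q" "finite R"
    and disj: "P \<inter> Q = {}" "Q \<inter> R = {}" "P \<inter> R = {}"
    and sim: "\<And>p q r. p \<in> P \<Longrightarrow> q \<in> Q \<Longrightarrow> r \<in> R \<Longrightarrow> eps_similar \<epsilon> A B C {p, q, r}"
  shows "card P * card Q * card R + num_similar \<epsilon> A B C P + num_similar \<epsilon> A B C Q + num_similar \<epsilon> A B C R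
    \<le> num_similar \<epsilon> A B C (P \<union> Q \<union> R)"
proof -
  let ?T = "\<lambda>X. {t. t \<subseteq> X \<and> card t = 3 \<and> eps_similar \<epsilon> A B C t}"
  let ?g = "\<lambda>(p, q, r). {p, q, r}"
  let ?M = "?g ` (P \<times> Q \<times> R)"
  have finT: "finite (?T X)" if "finite X" for X
    by (rule finite_subset[of _ "Pow X"]) (use that in auto)
  have ne: "t \<noteq> {}" if "t \<in> ?T X" for t X using that by auto
  have inj: "inj_on ?g (P \<times> Q \<times> R)"
    by (rule inj_on_unordered_triple[OF disj])
  have cardM: "card ?M = card P * card Q * card R"
    by (simp add: card_image[OF inj] card_cartesian_product)
  have PQ: "?T P \<inter> ?T Q = {}" "(?T P \<union> ?T Q) \<inter> ?T R = {}"
    using ne disj by blast+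
  have meets: "t \<inter> P \<noteq> {} \<and> t \<inter> Q \<noteq> {}" if "t \<in> ?M" for t using that by auto
  have M: "(?T P \<union> ?T Q \<union> ?T R) \<inter> ?M = {}"
    using meets disj by blast
  have "card (?T P \<union> ?T Q \<union> ?T R \<union> ?M) = card (?T P) + card (?T Q) + card (?T R) + card ?M"
    using finT[OF fin(1)] finT[OF fin(2)] finT[OF fin(3)] fin PQ M
    by (simp only: card_Un_disjoint finite_Un finite_imageI finite_cartesian_product simp_thms)
  moreover have "card (?T P \<union> ?T Q \<union> ?T R \<union> ?M) \<le> card (?T (P \<union> Q \<union> R))"
  proof (rule card_mono[OF finT])
    have "?M \<subseteq> ?T (P \<union> Q \<union> R)"
    proof
      fix t assume "t \<in> ?M"
      then obtain p q r where t: "t = {p, q, r}" "p \<in> P" "q \<in> Q" "r \<in> R" by auto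
      then have "p \<noteq> q" "q \<noteq> r" "p \<noteq> r" using disj by auto
      then have "card t = 3" using t by simp
      with t sim[of p q r] show "t \<in> ?T (P \<union> Q \<union> R)" by auto
    qed
    then show "?T P \<union> ?T Q \<union> ?T R \<union> ?M \<subseteq> ?T (P \<union> Q \<union> R)" by blast
  qed (use fin in simp)
  ultimately show ?thesis unfolding num_similar_def cardM by linarith
qed

text \<open>The recursion for \<open>h_seq\<close> is a construction: put optimal configurations of \<open>a\<close>, \<open>b\<close> and \<open>c\<close>
points into tiny discs at the vertices of a small copy of \<open>A B C\<close>. Asking for configurations
inside any given disc makes the induction go through.\<close>

theorem h_seq_configuration:
  fixes A B C Z :: "real^2"
  assumes ne: "A \<noteq> B" "B \<noteq> C" "C \<noteq> A" and \<epsilon>: "\<epsilon> > 0" and "r > 0"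
  shows "\<exists>P. finite P \<and> card P = n \<and> P \<subseteq> ball Z r \<and> h_seq n \<le> num_similar \<epsilon> A B C P"
  using \<open>r > 0\<close>
proof (induction n arbitrary: Z r rule: less_induct)
  case (less n)
  show ?case
  proof (cases "n < 3")
    case True
    have "infinite (ball Z r)"
      using less.prems by (metis centre_in_ball finite_imp_not_open open_ball empty_iff)
    then obtain P where "finite P" "card P = n" "P \<subseteq> ball Z r"
      using infinite_arbitrarily_large by blast
    with True show ?thesis by (auto simp: h_seq_small)
  next
    case False
    then obtain a b c where abc: "a + b + c = n" "a < n" "b < n" "c < n"
      "h_seq n = a * b * c + h_seq a + h_seq b + h_seq c"
      by (metis h_seq_split not_less)
    \<comment> \<open>The scaling factor \<open>l\<close> is chosen so that the copy lies within \<open>r / 2\<close> of the centre.\<close>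
    define m where "m = norm A + norm B + norm C + 1"
    have m: "m > 0" "norm A < m" "norm B < m" "norm C < m"
      unfolding m_def using norm_ge_zero[of A] norm_ge_zero[of B] norm_ge_zero[of C] by linarith+
    define l where "l = r / (2 * m)"
    have l: "l > 0" using m less.prems by (simp add: l_def)
    define \<phi> where "\<phi> x = Z + l *\<^sub>R x" for x
    have inj: "\<phi> x = \<phi> y \<longleftrightarrow> x = y" for x y using l by (simp add: \<phi>_def)
    have near: "dist Z (\<phi> x) < r / 2" if "norm x < m" for x
    proof -
      have "dist Z (\<phi> x) = l * norm x" using l by (simp add: \<phi>_def dist_norm)
      also have "\<dots> < l * m" using that l by (intro mult_strict_left_mono)
      also have "\<dots> = r / 2" using m by (simp add: l_def)
      finally show ?thesis .
    qed
    have sim: "eps_similar \<epsilon> (\<phi> A) (\<phi> B) (\<phi> C) t = eps_similar \<epsilon> A B C t" for t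
      unfolding eps_similar_def \<phi>_def angle_at_homothety[OF l] ..
    from ne inj have "\<phi> A \<noteq> \<phi> B" "\<phi> B \<noteq> \<phi> C" "\<phi> C \<noteq> \<phi> A" by simp_all
    then obtain \<delta> where "\<delta> > 0" and
      \<delta>: "\<And>p q r. dist p (\<phi> A) < \<delta> \<Longrightarrow> dist q (\<phi> B) < \<delta> \<Longrightarrow> dist r (\<phi> C) < \<delta> \<Longrightarrow>
        p \<noteq> q \<and> q \<noteq> r \<and> p \<noteq> r \<and> eps_similar \<epsilon> A B C {p, q, r}"
      using eps_similar_perturb[of "\<phi> A" "\<phi> B" "\<phi> C" \<epsilon>] \<epsilon> unfolding sim by metis
    define s where "s = min \<delta> (r / 2)"
    have s: "s > 0" "s \<le> \<delta>" "s \<le> r / 2" using \<open>\<delta> > 0\<close> less.prems by (auto simp: s_def)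
    obtain P where P: "finite P" "card P = a" "P \<subseteq> ball (\<phi> A) s" "h_seq a \<le> num_similar \<epsilon> A B C P"
      using less.IH[OF abc(2) s(1)] by blast
    obtain Q where Q: "finite Q" "card Q = b" "Q \<subseteq> ball (\<phi> B) s" "h_seq b \<le> num_similar \<epsilon> A B C Q"
      using less.IH[OF abc(3) s(1)] by blast
    obtain R where R: "finite R" "card R = c" "R \<subseteq> ball (\<phi> C) s" "h_seq c \<le> num_similar \<epsilon> A B C R"
      using less.IH[OF abc(4) s(1)] by blast
    have cl: "x \<in> P \<Longrightarrow> dist x (\<phi> A) < \<delta>" "x \<in> Q \<Longrightarrow> dist x (\<phi> B) < \<delta>" "x \<in> R \<Longrightarrow> dist x (\<phi> C) < \<delta>" for x
      using subsetD[OF P(3), of x] subsetD[OF Q(3), of x] subsetD[OF R(3), of x] s(2)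
      unfolding mem_ball dist_commute[of x] by linarith+
    have z: "dist x x < \<delta>" for x :: "real^2" using \<open>\<delta> > 0\<close> by simp
    have "x \<notin> Q" if "x \<in> P" for x using \<delta>[OF cl(1)[OF that] cl(2) z] by blast
    moreover have "x \<notin> R" if "x \<in> Q" for x using \<delta>[OF z cl(2)[OF that] cl(3)] by blast
    moreover have "x \<notin> R" if "x \<in> P" for x using \<delta>[OF cl(1)[OF that] z cl(3)] by blast
    ultimately have disj: "P \<inter> Q = {}" "Q \<inter> R = {}" "P \<inter> R = {}" by blast+
    have sub: "ball (\<phi> x) s \<subseteq> ball Z r" if "norm x < m" for x
    proof
      fix y assume "y \<in> ball (\<phi> x) s"
      then show "y \<in> ball Z r"
        using near[OF that] s(3) dist_triangle[of Z y "\<phi> x"] by simp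
    qed
    have "h_seq n \<le> card P * card Q * card R + num_similar \<epsilon> A B C P + num_similar \<epsilon> A B C Q + num_similar \<epsilon> A B C R"
      unfolding abc(5) P(2) Q(2) R(2) using P(4) Q(4) R(4) by (intro add_mono order_refl)
    also have "\<dots> \<le> num_similar \<epsilon> A B C (P \<union> Q \<union> R)"
    proof (rule num_similar_union[OF P(1) Q(1) R(1) disj])
      show "eps_similar \<epsilon> A B C {p, q, r}" if "p \<in> P" "q \<in> Q" "r \<in> R" for p q r
        using \<delta>[OF cl(1)[OF that(1)] cl(2)[OF that(2)] cl(3)[OF that(3)]] by blast
    qed
    finally have "h_seq n \<le> num_similar \<epsilon> A B C (P \<union> Q \<union> R)" .
    moreover have "card (P \<union> Q \<union> R) = n"
    proof -
      have "(P \<union> Q) \<inter> R = {}" using disj by blast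
      then have "card (P \<union> Q \<union> R) = card P + card Q + card R"
        using P(1) Q(1) R(1) disj(1) by (simp add: card_Un_disjoint)
      then show ?thesis using P(2) Q(2) R(2) abc(1) by simp
    qed
    moreover have "P \<union> Q \<union> R \<subseteq> ball Z r"
      using order_trans[OF P(3) sub[OF m(2)]] order_trans[OF Q(3) sub[OF m(3)]]
        order_trans[OF R(3) sub[OF m(4)]] by simp
    moreover have "finite (P \<union> Q \<union> R)" using P(1) Q(1) R(1) by simp
    ultimately show ?thesis by (intro exI[of _ "P \<union> Q \<union> R"] conjI)
  qed
qed

section \<open>The maximal number of almost equilateral triangles\<close>

theorem theorem1p1:
  fixes A B C :: "real^2"
  assumes "equilateral A B C"
  shows "\<exists>\<epsilon>\<^sub>0::real. pi / 180 \<le> \<epsilon>\<^sub>0 \<and> \<epsilon>\<^sub>0 \<le> pi / 3 \<and>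
    (\<forall>\<epsilon>. 0 < \<epsilon> \<and> \<epsilon> < \<epsilon>\<^sub>0 \<longrightarrow>
      (\<forall>n. h_max n A B C \<epsilon> = h_seq n) \<and>
      (\<forall>n k. n = 3 ^ k \<longrightarrow> real (h_max n A B C \<epsilon>) = 1 / 24 * (real n ^ 3 - real n)))"
proof (intro exI[of _ "pi / 180"] conjI allI impI)
  fix \<epsilon> :: real assume \<epsilon>: "0 < \<epsilon> \<and> \<epsilon> < pi / 180"
  show max: "h_max n A B C \<epsilon> = h_seq n" for n
  proof (rule antisym)
    show "h_max n A B C \<epsilon> \<le> h_seq n"
      unfolding h_max_def Max_le_iff[OF h_max_set_finite h_max_set_nonempty]
      using num_similar_le_h_seq[OF assms, of \<epsilon>] \<epsilon> by auto
    obtain P where "finite P" "card P = n" "h_seq n \<le> num_similar \<epsilon> A B C P"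
      using h_seq_configuration[of A B C \<epsilon> 1 n 0] equilateral_distinct[OF assms] \<epsilon> by auto
    then show "h_seq n \<le> h_max n A B C \<epsilon>"
      unfolding h_max_def Max_ge_iff[OF h_max_set_finite h_max_set_nonempty] by blast
  qed
  show "real (h_max n A B C \<epsilon>) = 1 / 24 * (real n ^ 3 - real n)" if "n = 3 ^ k" for n k
  proof -
    have "real (24 * h_seq n + n) = real (n ^ 3)"
      using h_seq_power_of_3[of k] that by simp
    then show ?thesis unfolding max by simp
  qed
qed simp_all

end
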